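(* Let $d\ge1$ be an integer. Statement (S) below holds for any fixed off-diagonal coefficients $\beta_{ij}=\beta_{ji}\in[-\frac1{10d^2},\frac1{10d^2}]$ $(i<j)$ and almost all $(\beta_{11},\dots,\beta_{dd})\in[1,2]^d$. Moreover, (S) also holds for almost all symmetric matrices $(\beta_{ij})$ with $\beta_{ij}=\beta_{ji}\in[-\frac1{10d^2},\frac1{10d^2}]$ for $i\ne j$ and $\beta_{11},\dots,\beta_{dd}\in[1,2]$. (S): For every integer $b\ge1$, every $\lambda,\delta$ with $0<\delta<1<\lambda$, and every $\epsilon>0$, $$\|P_{\lambda,\delta}\|_{L^1(\mathbb{T}^d)\to L^\infty(\mathbb{T}^d)}\le C\,\delta^{-1/b}\lambda^{\epsilon}\left[\max_{0\le b_2\le\min(b,d+1)}\delta^{b_2}\lambda^{-b_2^2+(b+d)b_2+1-b}\right]^{1/b},$$ where the maximum is over integers $b_2$. In particular, for every integer $a\ge1$, every $\epsilon>0$ and all $0<\delta<1<\lambda$ with $\lambda^{-a}\le\delta\le\lambda^{1-a}$, $$\|P_{\lambda,\delta}\|_{L^1(\mathbb{T}^d)\to L^\infty(\mathbb{T}^d)}\le C\cdot\begin{cases}\delta^{1-\frac1{d+1-a}}\,\lambda^{d-1+\frac1{d+1-a}+\epsilon}&(a<d),\\[2pt]\delta^{1-\frac{1+a}{d+1+a}}\,\lambda^{d-1+\frac{1+a}{d+1+a}+\epsilon}&(a\ge d).\end{cases}$$ Here the constants $C$ depend only on $\beta$ and $\epsilon$ (and on $d$ and the cutoff $\chi$).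
   Context: $\mathbb{T}^d=\mathbb{R}^d/\mathbb{Z}^d$. Given a real symmetric positive definite matrix $\beta=(\beta_{ij})_{1\le i,j\le d}$, let $\mathcal{Q}(x)=\sum_{i,j=1}^d\beta_{ij}x_ix_j$. Let $\chi$ be a fixed cutoff function with values in $[0,1]$, supported in $[-1,1]$ and equal to $1$ on $[-\frac12,\frac12]$. For $f=\sum_{k\in\mathbb{Z}^d}\widehat f_k e^{2\pi i k\cdot x}$ on $\mathbb{T}^d$, the spectral projector is the Fourier multiplier $$P_{\lambda,\delta}f=\sum_{k\in\mathbb{Z}^d}\chi\left(\frac{\sqrt{\mathcal{Q}(k)}-\lambda}{\delta}\right)\widehat f_k\,e^{2\pi i k\cdot x}.$$ "Almost all" refers to Lebesgue measure. *)

theory Defs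
  imports "HOL-Probability.Probability"
begin

text \<open>
  Vectors of dimension \<open>d\<close> are functions on the index set \<open>{1..d}\<close>, and Lebesgue measure on
  \<open>d\<close>-dimensional space is the product measure \<open>\<Pi>\<^sub>M i\<in>{1..d}. lborel\<close>.  The torus is identified
  with its fundamental domain, the half-open unit cube, and carries the normalised Haar measure;
  functions on the torus are thus functions on the cube (equivalently, periodic functions).
\<close>

definition torus :: "nat \<Rightarrow> (nat \<Rightarrow> real) measure" where
  "torus d = Pi\<^sub>M {1..d} (\<lambda>_. restrict_space lborel {0..<1})"

definition lattice :: "nat \<Rightarrow> (nat \<Rightarrow> int) set" where
  "lattice d = {1..d} \<rightarrow>\<^sub>E (UNIV :: int set)"

definition quad_form :: "nat \<Rightarrow> (nat \<Rightarrow> nat \<Rightarrow> real) \<Rightarrow> (nat \<Rightarrow> real) \<Rightarrow> real" where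
  "quad_form d \<beta> x = (\<Sum>i=1..d. \<Sum>j=1..d. \<beta> i j * x i * x j)"

definition character :: "nat \<Rightarrow> (nat \<Rightarrow> int) \<Rightarrow> (nat \<Rightarrow> real) \<Rightarrow> complex" where
  "character d k x = cis (2 * pi * (\<Sum>i=1..d. real_of_int (k i) * x i))"

definition fourier_coeff :: "nat \<Rightarrow> ((nat \<Rightarrow> real) \<Rightarrow> complex) \<Rightarrow> (nat \<Rightarrow> int) \<Rightarrow> complex" where
  "fourier_coeff d f k = (LINT x|torus d. f x * cnj (character d k x))"

definition is_cutoff :: "(real \<Rightarrow> real) \<Rightarrow> bool" where
  "is_cutoff chi \<longleftrightarrow>
     (\<forall>x. 0 \<le> chi x \<and> chi x \<le> 1) \<and>
     closure {x. chi x \<noteq> 0} \<subseteq> {- 1..1} \<and>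
     (\<forall>x\<in>{- 1 / 2..1 / 2}. chi x = 1)"

text \<open>For positive definite \<open>\<beta>\<close> and \<open>\<delta> > 0\<close> only finitely many terms of the sum are nonzero.\<close>

definition spectral_proj ::
  "(real \<Rightarrow> real) \<Rightarrow> nat \<Rightarrow> (nat \<Rightarrow> nat \<Rightarrow> real) \<Rightarrow> real \<Rightarrow> real \<Rightarrow>
   ((nat \<Rightarrow> real) \<Rightarrow> complex) \<Rightarrow> (nat \<Rightarrow> real) \<Rightarrow> complex" where
  "spectral_proj chi d \<beta> lam \<delta> f x =
     (\<Sum>\<^sub>\<infinity>k\<in>lattice d.
        complex_of_real (chi ((sqrt (quad_form d \<beta> (\<lambda>i. real_of_int (k i))) - lam) / \<delta>)) *
        fourier_coeff d f k * character d k x)"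

definition L1_Linf_norm ::
  "'a measure \<Rightarrow> (('a \<Rightarrow> complex) \<Rightarrow> ('a \<Rightarrow> complex)) \<Rightarrow> ennreal" where
  "L1_Linf_norm M T =
     (SUP f\<in>{f. integrable M f \<and> (LINT x|M. norm (f x)) \<le> 1}.
        esssup M (\<lambda>x. ennreal (norm (T f x))))"

text \<open>In the two bounds below, the constant depends only on \<open>chi\<close>, \<open>d\<close>, \<open>\<beta>\<close> and \<open>\<epsilon>\<close>.\<close>

definition moment_bound :: "(real \<Rightarrow> real) \<Rightarrow> nat \<Rightarrow> (nat \<Rightarrow> nat \<Rightarrow> real) \<Rightarrow> bool" where
  "moment_bound chi d \<beta> \<longleftrightarrow>
     (\<forall>\<epsilon>>0. \<exists>C>0. \<forall>b\<ge>1. \<forall>lam \<delta>. 0 < \<delta> \<and> \<delta> < 1 \<and> 1 < lam \<longrightarrow>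
        L1_Linf_norm (torus d) (spectral_proj chi d \<beta> lam \<delta>) \<le>
        ennreal (C * \<delta> powr (- 1 / real b) * lam powr \<epsilon> *
          (MAX b\<^sub>2\<in>{0..min b (d + 1)}.
             \<delta> ^ b\<^sub>2 * lam powi (- (int b\<^sub>2)\<^sup>2 + (int b + int d) * int b\<^sub>2 + 1 - int b))
          powr (1 / real b)))"

definition range_bound :: "(real \<Rightarrow> real) \<Rightarrow> nat \<Rightarrow> (nat \<Rightarrow> nat \<Rightarrow> real) \<Rightarrow> bool" where
  "range_bound chi d \<beta> \<longleftrightarrow>
     (\<forall>\<epsilon>>0. \<exists>C>0. \<forall>a::nat\<ge>1. \<forall>lam \<delta>.
        0 < \<delta> \<and> \<delta> < 1 \<and> 1 < lam \<and> lam powi (- int a) \<le> \<delta> \<and> \<delta> \<le> lam powi (1 - int a) \<longrightarrow>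
        L1_Linf_norm (torus d) (spectral_proj chi d \<beta> lam \<delta>) \<le>
        ennreal (C *
          (if a < d then
             \<delta> powr (1 - 1 / (real d + 1 - real a)) *
             lam powr (real d - 1 + 1 / (real d + 1 - real a) + \<epsilon>)
           else
             \<delta> powr (1 - (1 + real a) / (real d + 1 + real a)) *
             lam powr (real d - 1 + (1 + real a) / (real d + 1 + real a) + \<epsilon>))))"

definition statement_S :: "(real \<Rightarrow> real) \<Rightarrow> nat \<Rightarrow> (nat \<Rightarrow> nat \<Rightarrow> real) \<Rightarrow> bool" where
  "statement_S chi d \<beta> \<longleftrightarrow> moment_bound chi d \<beta> \<and> range_bound chi d \<beta>"

definition admissible_off_diag :: "nat \<Rightarrow> (nat \<Rightarrow> nat \<Rightarrow> real) \<Rightarrow> bool" where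
  "admissible_off_diag d \<beta> \<longleftrightarrow>
     (\<forall>i\<in>{1..d}. \<forall>j\<in>{1..d}. i \<noteq> j \<longrightarrow>
        \<beta> i j = \<beta> j i \<and> \<beta> i j \<in> {- 1 / (10 * real d ^ 2)..1 / (10 * real d ^ 2)})"

definition with_diag :: "(nat \<Rightarrow> nat \<Rightarrow> real) \<Rightarrow> (nat \<Rightarrow> real) \<Rightarrow> nat \<Rightarrow> nat \<Rightarrow> real" where
  "with_diag \<beta> v = (\<lambda>i j. if i = j then v i else \<beta> i j)"

text \<open>
  Symmetric matrices are parametrised by their entries on and above the diagonal, which gives
  Lebesgue measure on the \<open>d * (d + 1) / 2\<close>-dimensional space of symmetric matrices.
\<close>

definition upper_indices :: "nat \<Rightarrow> (nat \<times> nat) set" where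
  "upper_indices d = {(i, j). 1 \<le> i \<and> i \<le> j \<and> j \<le> d}"

definition sym_matrix :: "(nat \<times> nat \<Rightarrow> real) \<Rightarrow> nat \<Rightarrow> nat \<Rightarrow> real" where
  "sym_matrix w = (\<lambda>i j. w (min i j, max i j))"

end

theory Submission
  imports Defs
begin

text \<open>
  A Fourier coefficient of \<open>f\<close> is at most the \<open>L\<^sup>1\<close> norm of \<open>f\<close>, so the norm of the spectral projector
  is at most the number \<open>N\<close> of lattice points \<open>k\<close> with \<open>\<bar>sqrt (Q k) - \<lambda>\<bar> \<le> \<delta>\<close>
  (\<open>L1_Linf_norm_le_card\<close>).  What has to be shown is a bound for \<open>N\<close> that holds for almost every
  form \<open>Q\<close>, simultaneously for all \<open>\<lambda>\<close> and \<open>\<delta>\<close>.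

  The \<open>b\<close>-th power of \<open>N\<close> is bounded by a quantity in which \<open>\<lambda>\<close> enters only through its order of
  magnitude.  If \<open>k\<^sub>0, \<dots>, k\<^sub>m\<close> with \<open>m = b - 1\<close> lie in the shell, then
  \<open>\<bar>Q k\<^sub>i - Q k\<^sub>0\<bar> \<le> 8 \<lambda> \<delta>\<close>; hence \<open>N ^ b\<close> is at most the number of tuples with this property
  (\<open>close_tuples\<close>), and taking the supremum over the \<open>\<lambda>\<close> of one dyadic scale costs nothing.  This number
  is then averaged over the diagonal coefficients.  For a fixed tuple the conditions are \<open>m\<close> linear
  inequalities for the vector of diagonal coefficients, with matrix \<open>k\<^sub>i\<^sub>j\<^sup>2 - k\<^sub>0\<^sub>j\<^sup>2\<close>; the off-diagonal
  coefficients contribute only to the constant terms, and all bounds are uniform in these.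

  The sum over all tuples of the measures of the solution sets is estimated by Gaussian elimination
  with complete pivoting (\<open>slab_vol_eliminate\<close>, \<open>slab_vol_sum_le\<close>).  Suppose that column \<open>j\<close> only
  contains integers of size about \<open>X j\<close>, and measure the entries of column \<open>j\<close> in units of \<open>X j\<close>.
  If the largest entry has size \<open>u > 1\<close> and sits in column \<open>q\<close>, then elimination gains a factor
  \<open>\<eta> / (u * X q)\<close> in measure, where \<open>\<eta>\<close> is the width of the inequalities, and each entry of the
  pivot row and of the pivot column leaves only \<open>O(u)\<close> choices for its integer, because consecutive
  squares of size \<open>(X j)\<^sup>2\<close> are about \<open>X j\<close> apart.  What remains is a matrix of the same type,
  squares minus numbers that are determined by the pivot row and column, so the argument can be
  repeated.  Once all entries have size at most 1, every integer is determined up to \<open>O(1)\<close> choices.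
  The total is largest when all pivots are as large as possible, and \<open>r\<close> pivots then yield
  \<open>\<delta> ^ r * \<lambda> ^ (d + r * (m + d) - r * (r + 1))\<close>, up to logarithms.  This is \<open>1 / \<delta>\<close> times the term
  \<open>b\<^sub>2 = r + 1\<close> of the maximum in the theorem; the sum of these terms is \<open>moment_sum\<close>.
  In order to have integers of comparable size in each column, the shell is first cut into
  dyadic boxes; there are only \<open>O((log \<lambda>) ^ d)\<close> of them.

  Dividing the tuple counts by these bounds and by \<open>\<lambda> ^ \<epsilon>\<close> and summing over all dyadic scales of
  \<open>\<lambda>\<close> and \<open>\<delta> \<ge> \<lambda> ^ (-A)\<close> gives a function with finite integral.  It is finite for almost every form,
  which bounds all the counts at once (\<open>AE_close_tuples_bound\<close>).

  The constants obtained so far depend on \<open>b\<close> and \<open>A\<close>.  They become uniform because only finitely many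
  \<open>b\<close> matter (\<open>shell_card_uniform\<close>): the counts decrease with \<open>\<delta>\<close>, and for \<open>\<delta> = \<lambda> ^ (-A)\<close> with large
  \<open>A\<close> the choice \<open>b = A + d + 1\<close> already gives \<open>N \<le> C * \<lambda> ^ \<epsilon>\<close>; for larger \<open>\<delta>\<close> and large \<open>b\<close> the claim
  follows from the case \<open>b = 1\<close>, which is the count by volume.  The bounds in terms of \<open>a\<close> come from the choices
  \<open>b = d + 1 - a\<close> and \<open>b = d + 1 + a\<close>, for which the term with the largest \<open>b\<^sub>2\<close> dominates.
\<close>

section \<open>Slabs and Gaussian elimination\<close>

definition slab :: "'r set \<Rightarrow> 'c set \<Rightarrow> ('r \<Rightarrow> 'c \<Rightarrow> real) \<Rightarrow> ('r \<Rightarrow> real) \<Rightarrow> real \<Rightarrow> ('c \<Rightarrow> real) set" where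
  "slab I J a c \<eta> = {v \<in> J \<rightarrow>\<^sub>E {1..2}. \<forall>i\<in>I. \<bar>(\<Sum>j\<in>J. a i j * v j) + c i\<bar> \<le> \<eta>}"

text \<open>
  The supremum over the constant terms \<open>c\<close> serves two purposes.  Off-diagonal coefficients of the
  quadratic form enter only through \<open>c\<close>, so bounds for \<open>slab_vol\<close> are uniform in them; and row
  operations, which change \<open>c\<close>, need not keep track of it.
\<close>

definition slab_vol :: "'r set \<Rightarrow> 'c set \<Rightarrow> ('r \<Rightarrow> 'c \<Rightarrow> real) \<Rightarrow> real \<Rightarrow> real" where
  "slab_vol I J a \<eta> = enn2real (SUP c. emeasure (Pi\<^sub>M J (\<lambda>_. lborel)) (slab I J a c \<eta>))"

lemma product_lborel: "product_sigma_finite (\<lambda>_::'c. lborel :: real measure)"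
  by standard

lemma box_sets: "finite J \<Longrightarrow> J \<rightarrow>\<^sub>E {l..u::real} \<in> sets (Pi\<^sub>M J (\<lambda>_. lborel))"
  by (intro sets_PiM_I_finite) auto

lemma slab_sets:
  assumes "finite I" "finite J"
  shows "slab I J a c \<eta> \<in> sets (Pi\<^sub>M J (\<lambda>_. lborel))"
proof -
  have *: "slab I J a c \<eta> = (J \<rightarrow>\<^sub>E {1..2}) \<inter>
      {v \<in> space (Pi\<^sub>M J (\<lambda>_. lborel)). \<forall>i\<in>I. \<bar>(\<Sum>j\<in>J. a i j * v j) + c i\<bar> \<le> \<eta>}"
    by (auto simp: slab_def space_PiM PiE_def)
  have "{v \<in> space (Pi\<^sub>M J (\<lambda>_. lborel)). \<forall>i\<in>I. \<bar>(\<Sum>j\<in>J. a i j * v j) + c i\<bar> \<le> \<eta>} \<in> sets (Pi\<^sub>M J (\<lambda>_. lborel))"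
    using assms by measurable
  then show ?thesis unfolding * using box_sets[OF assms(2)] by blast
qed

lemma slab_emeasure_le_1:
  assumes "finite J"
  shows "emeasure (Pi\<^sub>M J (\<lambda>_. lborel)) (slab I J a c \<eta>) \<le> 1"
proof -
  interpret product_sigma_finite "\<lambda>_::'c. lborel :: real measure" by (rule product_lborel)
  have "emeasure (Pi\<^sub>M J (\<lambda>_. lborel)) (slab I J a c \<eta>) \<le> emeasure (Pi\<^sub>M J (\<lambda>_. lborel)) (J \<rightarrow>\<^sub>E {1..2::real})"
    by (rule emeasure_mono) (auto simp: slab_def intro: box_sets assms)
  also have "\<dots> = (\<Prod>j\<in>J. emeasure lborel {1..2::real})"
    by (rule emeasure_PiM) (auto simp: assms)
  also have "\<dots> = 1" by simp
  finally show ?thesis .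
qed

lemma slab_vol_ennreal:
  assumes "finite J"
  shows "ennreal (slab_vol I J a \<eta>) = (SUP c. emeasure (Pi\<^sub>M J (\<lambda>_. lborel)) (slab I J a c \<eta>))"
proof -
  have "(SUP c. emeasure (Pi\<^sub>M J (\<lambda>_. lborel)) (slab I J a c \<eta>)) \<le> 1"
    by (intro SUP_least slab_emeasure_le_1 assms)
  then have "(SUP c. emeasure (Pi\<^sub>M J (\<lambda>_. lborel)) (slab I J a c \<eta>)) < top"
    by (rule order_le_less_trans) simp
  then show ?thesis unfolding slab_vol_def by (simp add: less_top)
qed

lemma emeasure_slab_le:
  assumes "finite J"
  shows "emeasure (Pi\<^sub>M J (\<lambda>_. lborel)) (slab I J a c \<eta>) \<le> ennreal (slab_vol I J a \<eta>)"
  unfolding slab_vol_ennreal[OF assms] by (rule SUP_upper) simp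

lemma slab_vol_nonneg [simp]: "0 \<le> slab_vol I J a \<eta>"
  by (simp add: slab_vol_def)

lemma slab_vol_leI:
  assumes "finite J" "0 \<le> B"
    and "\<And>c. emeasure (Pi\<^sub>M J (\<lambda>_. lborel)) (slab I J a c \<eta>) \<le> ennreal B"
  shows "slab_vol I J a \<eta> \<le> B"
proof -
  have "ennreal (slab_vol I J a \<eta>) \<le> ennreal B"
    unfolding slab_vol_ennreal[OF assms(1)] using assms(3) by (rule SUP_least)
  then show ?thesis using assms(2) by simp
qed

lemma slab_vol_le_1: "finite J \<Longrightarrow> slab_vol I J a \<eta> \<le> 1"
  by (rule slab_vol_leI) (simp_all add: slab_emeasure_le_1)

lemma slab_vol_cong:
  assumes "\<And>i j. i \<in> I \<Longrightarrow> j \<in> J \<Longrightarrow> a i j = a' i j"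
  shows "slab_vol I J a \<eta> = slab_vol I J a' \<eta>"
proof -
  have "slab I J a c \<eta> = slab I J a' c \<eta>" for c
    unfolding slab_def using assms by (auto cong: sum.cong)
  then show ?thesis unfolding slab_vol_def by simp
qed

text \<open>
  For fixed values of the other coordinates, row \<open>p\<close> confines the coordinate \<open>q\<close> to an interval of
  length \<open>2 * \<eta> / \<bar>a p q\<bar>\<close>.  Subtracting multiples of row \<open>p\<close> removes this coordinate from the other
  rows; the multipliers have absolute value at most 1 since \<open>a p q\<close> is the largest entry of its
  column, so the tolerance is at most doubled.  Integrating over the coordinate \<open>q\<close> first gives the
  claim.
\<close>

lemma slab_vol_eliminate:
  assumes fin: "finite I" "finite J" and p: "p \<in> I" "q \<in> J" and nz: "a p q \<noteq> 0" and \<eta>: "0 \<le> \<eta>"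
    and piv: "\<And>i. i \<in> I \<Longrightarrow> \<bar>a i q\<bar> \<le> \<bar>a p q\<bar>"
  shows "slab_vol I J a \<eta> \<le> 2 * \<eta> / \<bar>a p q\<bar> *
    slab_vol (I - {p}) (J - {q}) (\<lambda>i j. a i j - a i q / a p q * a p j) (2 * \<eta>)" (is "_ \<le> ?K * ?V")
proof (rule slab_vol_leI)
  show "finite J" by fact
  show "0 \<le> ?K * ?V" using \<eta> by simp
  fix c
  interpret product_sigma_finite "\<lambda>_::'b. lborel :: real measure" by (rule product_lborel)
  let ?J = "J - {q}" and ?I = "I - {p}"
  let ?a = "\<lambda>i j. a i j - a i q / a p q * a p j" and ?c = "\<lambda>i. c i - a i q / a p q * c p"
  let ?A = "slab I J a c \<eta>" and ?B = "slab ?I ?J ?a ?c (2 * \<eta>)"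
  have J: "insert q ?J = J" "finite ?J" "q \<notin> ?J" using fin p by auto
  have split_sum: "(\<Sum>j\<in>J. a i j * (v(q := y)) j) = a i q * y + (\<Sum>j\<in>?J. a i j * v j)" for i v y
    by (subst sum.remove[OF fin(2) p(2)]) (auto intro!: sum.cong)
  define y0 where "y0 v = - ((\<Sum>j\<in>?J. a p j * v j) + c p) / a p q" for v
  define r where "r = \<eta> / \<bar>a p q\<bar>"
  have r: "0 \<le> r" using \<eta> by (simp add: r_def)
  have ind: "indicator ?A (v(q := y)) \<le> (indicator ?B v * indicator {y0 v - r..y0 v + r} y :: ennreal)"
    if v: "v \<in> space (Pi\<^sub>M ?J (\<lambda>_. lborel))" for v y
  proof (cases "v(q := y) \<in> ?A")
    case True
    then have box: "v(q := y) \<in> J \<rightarrow>\<^sub>E {1..2}"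
      and eq: "\<And>i. i \<in> I \<Longrightarrow> \<bar>a i q * y + (\<Sum>j\<in>?J. a i j * v j) + c i\<bar> \<le> \<eta>"
      by (auto simp: slab_def split_sum[symmetric])
    have vbox: "v \<in> ?J \<rightarrow>\<^sub>E {1..2}"
      unfolding PiE_iff
    proof (intro conjI ballI)
      fix j assume "j \<in> ?J"
      then show "v j \<in> {1..2}" using PiE_mem[OF box, of j] by auto
    next
      show "v \<in> extensional ?J" using v by (auto simp: space_PiM PiE_iff)
    qed
    have row: "\<bar>(\<Sum>j\<in>?J. ?a i j * v j) + ?c i\<bar> \<le> 2 * \<eta>" if i: "i \<in> ?I" for i
    proof -
      let ?m = "a i q / a p q"
      have m: "\<bar>?m\<bar> \<le> 1" using piv[of i] i nz by (simp add: abs_divide)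
      have "(\<Sum>j\<in>?J. ?a i j * v j) + ?c i
          = (a i q * y + (\<Sum>j\<in>?J. a i j * v j) + c i) - ?m * (a p q * y + (\<Sum>j\<in>?J. a p j * v j) + c p)"
        using nz by (simp add: algebra_simps sum_subtractf sum_distrib_left)
      also have "\<bar>\<dots>\<bar> \<le> \<bar>a i q * y + (\<Sum>j\<in>?J. a i j * v j) + c i\<bar>
           + \<bar>?m\<bar> * \<bar>a p q * y + (\<Sum>j\<in>?J. a p j * v j) + c p\<bar>"
        by (simp only: abs_mult[symmetric] abs_triangle_ineq4)
      also have "\<dots> \<le> \<eta> + 1 * \<eta>"
        using i p m eq[of i] eq[of p] by (intro add_mono mult_mono) auto
      finally show ?thesis by simp
    qed
    have "\<bar>y - y0 v\<bar> \<le> r"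
    proof -
      have "\<bar>y - y0 v\<bar> = \<bar>a p q * y + (\<Sum>j\<in>?J. a p j * v j) + c p\<bar> / \<bar>a p q\<bar>"
        using nz unfolding abs_divide[symmetric] y0_def by (simp add: field_simps)
      also have "\<dots> \<le> r" unfolding r_def using eq[of p] p by (intro divide_right_mono) auto
      finally show ?thesis .
    qed
    then have "y \<in> {y0 v - r..y0 v + r}" by auto
    moreover have "v \<in> ?B" using vbox row by (auto simp: slab_def)
    ultimately show ?thesis using True by simp
  qed simp
  have meas: "(indicator ?A :: _ \<Rightarrow> ennreal) \<in> borel_measurable (Pi\<^sub>M (insert q ?J) (\<lambda>_. lborel))"
    unfolding J(1) using slab_sets[OF fin] by simp
  have "emeasure (Pi\<^sub>M J (\<lambda>_. lborel)) ?A = (\<integral>\<^sup>+v. indicator ?A v \<partial>Pi\<^sub>M J (\<lambda>_. lborel))"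
    using slab_sets[OF fin] by simp
  also have "\<dots> = (\<integral>\<^sup>+v. (\<integral>\<^sup>+y. indicator ?A (v(q := y)) \<partial>lborel) \<partial>Pi\<^sub>M ?J (\<lambda>_. lborel))"
    using product_nn_integral_insert[OF J(2,3) meas] unfolding J(1) .
  also have "\<dots> \<le> (\<integral>\<^sup>+v. (\<integral>\<^sup>+y. indicator ?B v * indicator {y0 v - r..y0 v + r} y \<partial>lborel) \<partial>Pi\<^sub>M ?J (\<lambda>_. lborel))"
    by (intro nn_integral_mono ind)
  also have "\<dots> = (\<integral>\<^sup>+v. ennreal (2 * r) * indicator ?B v \<partial>Pi\<^sub>M ?J (\<lambda>_. lborel))"
  proof (rule nn_integral_cong)
    fix v
    have "(\<integral>\<^sup>+y. indicator ?B v * indicator {y0 v - r..y0 v + r} y \<partial>lborel)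
        = indicator ?B v * emeasure lborel {y0 v - r..y0 v + r}"
      by (rule nn_integral_cmult_indicator) simp
    then show "(\<integral>\<^sup>+y. indicator ?B v * indicator {y0 v - r..y0 v + r} y \<partial>lborel) = ennreal (2 * r) * indicator ?B v"
      using r by (simp add: mult.commute)
  qed
  also have "\<dots> = ennreal (2 * r) * emeasure (Pi\<^sub>M ?J (\<lambda>_. lborel)) ?B"
    using slab_sets[of ?I ?J] fin by (subst nn_integral_cmult_indicator) auto
  also have "\<dots> \<le> ennreal (2 * r) * ennreal ?V"
    by (intro mult_left_mono emeasure_slab_le) (auto simp: fin)
  also have "\<dots> = ennreal (?K * ?V)"
    using r by (subst ennreal_mult[symmetric]) (auto simp: r_def)
  finally show "emeasure (Pi\<^sub>M J (\<lambda>_. lborel)) ?A \<le> ennreal (?K * ?V)" .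
qed

section \<open>Complete pivoting over matrices of shifted squares\<close>

lemma sum_PiE_Un:
  assumes "P \<inter> Q = {}"
  shows "(\<Sum>k\<in>PiE (P \<union> Q) F. f (restrict k P) (restrict k Q)) = (\<Sum>p\<in>PiE P F. \<Sum>q\<in>PiE Q F. f p q)"
  unfolding sum.cartesian_product
  by (rule sum.reindex_bij_witness[where i = "merge P Q" and j = "\<lambda>k. (restrict k P, restrict k Q)"])
     (use assms in \<open>auto simp: PiE_iff restrict_merge merge_def extensional_def fun_eq_iff split: if_splits\<close>)

lemma dyadic_scale:
  fixes u :: real
  assumes "1 \<le> u" "u < 2 ^ E"
  obtains e where "e < E" "2 ^ e \<le> u" "u < 2 ^ Suc e"
proof -
  define n where "n = (LEAST n. u < 2 ^ n)"
  have n: "u < 2 ^ n" "n \<le> E" unfolding n_def using assms(2) by (rule LeastI, rule Least_le)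
  have "n \<noteq> 0" using n(1) assms(1) by (cases n) auto
  then obtain e where e: "n = Suc e" by (cases n) auto
  have "\<not> u < 2 ^ e" using not_less_Least[of e "\<lambda>n. u < 2 ^ n"] e unfolding n_def by auto
  then show thesis using that[of e] n e by auto
qed

text \<open>
  The entry \<open>a p q\<close>, measured in units of \<open>X q\<close>, is a pivot of dyadic class \<open>e\<close>.  The class \<open>E\<close> is
  open-ended: it contains all pivots of relative size at least \<open>2 ^ E\<close> and gives no upper bound for
  the entries of the pivot row and column.  There the trivial count will do, because \<open>X j \<le> 2 ^ E\<close>.
\<close>

definition pivot_cond :: "'r set \<Rightarrow> 'c set \<Rightarrow> ('c \<Rightarrow> real) \<Rightarrow> nat \<Rightarrow> ('r \<Rightarrow> 'c \<Rightarrow> real) \<Rightarrow> 'r \<Rightarrow> 'c \<Rightarrow> nat \<Rightarrow> bool" where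
  "pivot_cond I J X E a p q e \<longleftrightarrow>
     2 ^ e * X q \<le> \<bar>a p q\<bar> \<and> (\<forall>i\<in>I. \<bar>a i q\<bar> \<le> \<bar>a p q\<bar>) \<and>
     (e < E \<longrightarrow> (\<forall>j\<in>J. \<bar>a p j\<bar> \<le> 2 ^ Suc e * X j) \<and> (\<forall>i\<in>I. \<bar>a i q\<bar> \<le> 2 ^ Suc e * X q))"

text \<open>
  The scaling by \<open>X j\<close> makes the columns comparable: a window of length \<open>u * X j\<close> contains \<open>O(u)\<close>
  squares of integers of size \<open>X j\<close>, whatever \<open>X j\<close> is.
\<close>

lemma pivot_exists:
  fixes a :: "'r \<Rightarrow> 'c \<Rightarrow> real"
  assumes fin: "finite I" "finite J" and X: "\<And>j. j \<in> J \<Longrightarrow> 0 < X j"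
    and big: "\<not> (\<forall>i\<in>I. \<forall>j\<in>J. \<bar>a i j\<bar> \<le> X j)"
  obtains p q e where "p \<in> I" "q \<in> J" "e \<le> E" "pivot_cond I J X E a p q e"
proof -
  \<comment> \<open>The pivot is the entry that is largest after scaling column \<open>j\<close> by \<open>1 / X j\<close>.\<close>
  define h where "h = (\<lambda>(i, j). \<bar>a i j\<bar> / X j)"
  have ne: "I \<times> J \<noteq> {}" using big by auto
  obtain z where z: "z \<in> I \<times> J" "\<And>y. y \<in> I \<times> J \<Longrightarrow> h y \<le> h z"
    using obtains_MAX[of "I \<times> J" h] fin ne by (metis Max_ge finite_SigmaI finite_imageI imageI)
  obtain p q where pq: "z = (p, q)" "p \<in> I" "q \<in> J" using z(1) by auto
  define u where "u = \<bar>a p q\<bar> / X q"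
  have u: "\<bar>a i j\<bar> \<le> u * X j" if "i \<in> I" "j \<in> J" for i j
    using z(2)[of "(i, j)"] that X[of j] pq by (simp add: h_def u_def pos_divide_le_eq)
  have upq: "\<bar>a p q\<bar> = u * X q" using X[OF pq(3)] by (simp add: u_def)
  have u1: "1 \<le> u"
  proof (rule ccontr)
    assume "\<not> 1 \<le> u"
    then have "\<bar>a i j\<bar> \<le> X j" if "i \<in> I" "j \<in> J" for i j
      using u[OF that] mult_right_mono[of u 1 "X j"] X[OF that(2)] by linarith
    with big show False by blast
  qed
  have col: "\<forall>i\<in>I. \<bar>a i q\<bar> \<le> \<bar>a p q\<bar>" using u[OF _ pq(3)] upq by auto
  show thesis
  proof (cases "u < 2 ^ E")
    case True
    then obtain e where e: "e < E" "2 ^ e \<le> u" "u < 2 ^ Suc e" using dyadic_scale u1 by blast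
    have le: "\<bar>a i j\<bar> \<le> 2 ^ Suc e * X j" if "i \<in> I" "j \<in> J" for i j
      using u[OF that] mult_right_mono[of u "2 ^ Suc e" "X j"] e(3) X[OF that(2)] by linarith
    have "pivot_cond I J X E a p q e"
      unfolding pivot_cond_def using col le pq e(2) X[OF pq(3)] by (auto simp: upq intro!: mult_right_mono)
    then show thesis using that[of p q e] pq e by auto
  next
    case False
    then have "pivot_cond I J X E a p q E"
      unfolding pivot_cond_def using col X[OF pq(3)] by (auto simp: upq intro!: mult_right_mono)
    then show thesis using that[of p q E] pq by auto
  qed
qed

definition eliminate :: "('r \<Rightarrow> 'c \<Rightarrow> real) \<Rightarrow> 'r \<Rightarrow> 'c \<Rightarrow> 'r \<Rightarrow> 'c \<Rightarrow> real" where
  "eliminate a p q i j = a i j - a i q / a p q * a p j"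

text \<open>
  Summing over all positions and classes, instead of choosing one pivot for each matrix, loses only a
  factor \<open>O(E)\<close> and makes each summand depend on the pivot row and column in a simple way.
\<close>

lemma slab_vol_pivot_step:
  assumes fin: "finite I" "finite J" and X: "\<And>j. j \<in> J \<Longrightarrow> 0 < X j" and \<eta>: "0 \<le> \<eta>"
  shows "slab_vol I J a \<eta> \<le> (if \<forall>i\<in>I. \<forall>j\<in>J. \<bar>a i j\<bar> \<le> X j then 1 else 0) +
    (\<Sum>p\<in>I. \<Sum>q\<in>J. \<Sum>e\<le>E. if pivot_cond I J X E a p q e
       then 2 * \<eta> / (2 ^ e * X q) * slab_vol (I - {p}) (J - {q}) (eliminate a p q) (2 * \<eta>) else 0)"
    (is "_ \<le> _ + (\<Sum>p\<in>I. \<Sum>q\<in>J. \<Sum>e\<le>E. ?t p q e)")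
proof -
  have t0: "0 \<le> ?t p q e" if "q \<in> J" for p q e
    using X[OF that] \<eta> by auto
  have s0: "0 \<le> (\<Sum>e\<le>E. ?t p q e)" if "q \<in> J" for p q by (intro sum_nonneg t0 that)
  have ss0: "0 \<le> (\<Sum>q\<in>J. \<Sum>e\<le>E. ?t p q e)" for p by (intro sum_nonneg t0)
  have sss0: "0 \<le> (\<Sum>p\<in>I. \<Sum>q\<in>J. \<Sum>e\<le>E. ?t p q e)" by (intro sum_nonneg t0)
  show ?thesis
  proof (cases "\<forall>i\<in>I. \<forall>j\<in>J. \<bar>a i j\<bar> \<le> X j")
    case True
    then show ?thesis using slab_vol_le_1[OF fin(2), of I a \<eta>] sss0 by simp
  next
    case False
    obtain p q e where pq: "p \<in> I" "q \<in> J" "e \<le> E" and c: "pivot_cond I J X E a p q e"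
      using pivot_exists[where I = I and J = J and X = X and a = a and E = E, OF fin X False] by blast
    have a: "2 ^ e * X q \<le> \<bar>a p q\<bar>" "\<And>i. i \<in> I \<Longrightarrow> \<bar>a i q\<bar> \<le> \<bar>a p q\<bar>"
      using c by (auto simp: pivot_cond_def)
    have pos: "0 < 2 ^ e * X q" using X[OF pq(2)] by simp
    have "slab_vol I J a \<eta> \<le> 2 * \<eta> / \<bar>a p q\<bar> * slab_vol (I - {p}) (J - {q}) (eliminate a p q) (2 * \<eta>)"
      unfolding eliminate_def using a pos by (intro slab_vol_eliminate fin pq \<eta>) auto
    also have "\<dots> \<le> ?t p q e"
      using c a(1) pos \<eta> by (auto intro!: mult_right_mono divide_left_mono)
    also have "\<dots> \<le> (\<Sum>e\<le>E. ?t p q e)" using pq t0 by (intro member_le_sum) auto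
    also have "\<dots> \<le> (\<Sum>q\<in>J. \<Sum>e\<le>E. ?t p q e)" using pq s0 fin by (intro member_le_sum) auto
    also have "\<dots> \<le> (\<Sum>p\<in>I. \<Sum>q\<in>J. \<Sum>e\<le>E. ?t p q e)" using pq ss0 fin by (intro member_le_sum) auto
    finally show ?thesis using False by simp
  qed
qed

text \<open>
  The bound obtained by repeated elimination from an \<open>m \<times> n\<close> matrix whose columns have size at most
  \<open>2 ^ E\<close>.  The first summand of the last equation accounts for matrices without pivot.  In the second
  one, \<open>Suc m * Suc n * Suc E\<close> counts positions and classes of the pivot, and \<open>m + n + 1\<close> is the
  number of entries in its row and column.
\<close>

fun pivot_bound :: "real \<Rightarrow> nat \<Rightarrow> nat \<Rightarrow> nat \<Rightarrow> real \<Rightarrow> real" where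
  "pivot_bound \<kappa> E 0 n \<eta> = (2 ^ E) ^ n"
| "pivot_bound \<kappa> E (Suc m) 0 \<eta> = 1"
| "pivot_bound \<kappa> E (Suc m) (Suc n) \<eta> = \<kappa> ^ (Suc m * Suc n) * (2 ^ E) ^ Suc n +
     real (Suc m * Suc n * Suc E) * (2 * \<kappa>) ^ (m + n + 1) * (2 * \<eta>) * (2 ^ E) ^ (m + n) * pivot_bound \<kappa> E m n (2 * \<eta>)"

lemma pivot_bound_nonneg: "0 \<le> \<kappa> \<Longrightarrow> 0 \<le> \<eta> \<Longrightarrow> 0 \<le> pivot_bound \<kappa> E m n \<eta>"
  by (induction \<kappa> E m n \<eta> rule: pivot_bound.induct) auto

lemma card_PiE_le_power:
  assumes "finite P" "\<And>z. z \<in> P \<Longrightarrow> real (card (F z)) \<le> c"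
  shows "real (card (PiE P F)) \<le> c ^ card P"
proof -
  have "real (card (PiE P F)) = (\<Prod>z\<in>P. real (card (F z)))" by (simp add: card_PiE assms)
  also have "\<dots> \<le> (\<Prod>z\<in>P. c)" by (intro prod_mono) (auto simp: assms)
  finally show ?thesis by simp
qed

text \<open>
  For a pivot of relative size \<open>u\<close> the \<open>m + n + 1\<close> entries of its row and column allow at most
  \<open>(\<kappa> * u) ^ (m + n + 1)\<close> choices up to a constant, and the gain in measure is \<open>2 * \<eta> / (u * X q)\<close>.
  The product is increasing in \<open>u\<close>, so it is enough to know it for \<open>u = 2 ^ E\<close>.  The factor \<open>1 / X q\<close>
  is absorbed by the product of the \<open>X j\<close> on the left, which loses the column \<open>q\<close> in the induction.
  The offsets must be arbitrary for the induction, since elimination changes them.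
\<close>

lemma slab_vol_sum_le:
  fixes B :: "'c \<Rightarrow> int set" and X :: "'c \<Rightarrow> real" and off :: "'r \<Rightarrow> 'c \<Rightarrow> real"
  assumes "finite I" "finite J" "card I = m" "card J = n" "0 \<le> \<eta>" "1 \<le> \<kappa>"
    and "\<And>j. j \<in> J \<Longrightarrow> finite (B j)"
    and "\<And>j. j \<in> J \<Longrightarrow> 1 \<le> X j" "\<And>j. j \<in> J \<Longrightarrow> X j \<le> 2 ^ E"
    and "\<And>j. j \<in> J \<Longrightarrow> real (card (B j)) \<le> \<kappa> * X j"
    and "\<And>j x u. j \<in> J \<Longrightarrow> 1 \<le> u \<Longrightarrow> real (card {k \<in> B j. \<bar>(real_of_int k)\<^sup>2 - x\<bar> \<le> u * X j}) \<le> \<kappa> * u"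
  shows "(\<Prod>j\<in>J. X j) * (\<Sum>k\<in>PiE (I \<times> J) (\<lambda>(i, j). B j).
            slab_vol I J (\<lambda>i j. (real_of_int (k (i, j)))\<^sup>2 - off i j) \<eta>) \<le> pivot_bound \<kappa> E m n \<eta>"
  using assms
proof (induction \<kappa> E m n \<eta> arbitrary: I J off rule: pivot_bound.induct)
  case (1 \<kappa> E n \<eta>)
  have "(\<Prod>j\<in>J. X j) \<le> (\<Prod>j\<in>J. 2 ^ E)" using 1(8,9) by (intro prod_mono) (auto intro: order_trans[of 0 1])
  moreover have "I = {}" using 1 by simp
  moreover have "0 \<le> (\<Prod>j\<in>J. X j)" using 1(8) by (intro prod_nonneg) (auto intro: order_trans[of 0 1])
  ultimately show ?case using 1(4) slab_vol_le_1[OF 1(2)] by (auto intro: mult_mono order_trans[OF mult_left_le])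
next
  case (2 \<kappa> E m \<eta>)
  then show ?case using slab_vol_le_1[OF 2(2)] by simp
next
  case (3 \<kappa> E m n \<eta>)
  note fin = 3(2,3) and cI = 3(4) and cJ = 3(5) and \<eta> = 3(6) and \<kappa> = 3(7) and finB = 3(8)
    and X1 = 3(9) and XE = 3(10) and cB = 3(11) and cW = 3(12)
  have X0: "0 < X j" if "j \<in> J" for j using X1[OF that] by simp
  let ?K = "PiE (I \<times> J) (\<lambda>(i, j). B j)"
  let ?a = "\<lambda>k i j. (real_of_int (k (i, j)))\<^sup>2 - off i j"
  let ?PX = "\<Prod>j\<in>J. X j"
  let ?R = "2 ^ E :: real"
  have PX0: "0 \<le> ?PX" using X0 by (intro prod_nonneg) (auto intro: less_imp_le)
  have PXR: "?PX \<le> ?R ^ Suc n"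
  proof -
    have "?PX \<le> (\<Prod>j\<in>J. ?R)" using XE X0 by (intro prod_mono) (auto intro: less_imp_le)
    then show ?thesis using cJ by simp
  qed
  have finK: "finite ?K" using fin finB by (intro finite_PiE) auto
  define low where "low k \<longleftrightarrow> (\<forall>i\<in>I. \<forall>j\<in>J. \<bar>?a k i j\<bar> \<le> X j)" for k
  define t where "t p q e k = (if pivot_cond I J X E (?a k) p q e
       then 2 * \<eta> / (2 ^ e * X q) * slab_vol (I - {p}) (J - {q}) (eliminate (?a k) p q) (2 * \<eta>) else 0)" for p q e k
  have "(\<Sum>k\<in>?K. if low k then 1 else 0) = real (card {k \<in> ?K. low k})"
    using finK by (simp add: sum.If_cases Int_def)
  also have "{k \<in> ?K. low k} = PiE (I \<times> J) (\<lambda>(i, j). {k \<in> B j. \<bar>(real_of_int k)\<^sup>2 - off i j\<bar> \<le> 1 * X j})"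
    unfolding low_def by (auto simp: PiE_iff extensional_def)
  also have "real (card \<dots>) \<le> (\<kappa> * 1) ^ card (I \<times> J)"
    using fin cW[of _ 1] by (intro card_PiE_le_power) auto
  also have "\<dots> = \<kappa> ^ (Suc m * Suc n)" using cI cJ by (simp add: card_cartesian_product)
  finally have low: "(\<Sum>k\<in>?K. if low k then 1 else 0) \<le> \<kappa> ^ (Suc m * Suc n)" .
  have term_le: "?PX * (\<Sum>k\<in>?K. t p q e k)
       \<le> (2 * \<kappa>) ^ (m + n + 1) * (2 * \<eta>) * ?R ^ (m + n) * pivot_bound \<kappa> E m n (2 * \<eta>)"
    if pq: "p \<in> I" "q \<in> J" and e: "e \<le> E" for p q e
  proof -
    let ?I = "I - {p}" and ?J = "J - {q}"
    let ?P = "({p} \<times> J) \<union> (?I \<times> {q})" and ?Q = "?I \<times> ?J"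
    let ?F = "\<lambda>(i, j). B j"
    have PQ: "?P \<inter> ?Q = {}" "I \<times> J = ?P \<union> ?Q" using pq by auto
    have finP: "finite ?P" using fin by auto
    have cP: "card ?P = m + n + 1"
      using fin pq cI cJ by (subst card_Un_disjoint) (auto simp: card_cartesian_product)
    define C where "C x \<longleftrightarrow> (\<forall>(i, j)\<in>?P. e < E \<longrightarrow> \<bar>(real_of_int (x (i, j)))\<^sup>2 - off i j\<bar> \<le> 2 ^ Suc e * X j)"
      for x :: "'r \<times> 'c \<Rightarrow> int"
    \<comment> \<open>Elimination leaves squares minus numbers that only depend on the pivot row and column, so the
      induction hypothesis applies for each fixed choice of these.\<close>
    define off' where "off' x i j = off i j + ?a x i q / ?a x p q * ?a x p j" for x :: "'r \<times> 'c \<Rightarrow> int" and i j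
    define V where "V x y = slab_vol ?I ?J (\<lambda>i j. (real_of_int (y (i, j)))\<^sup>2 - off' x i j) (2 * \<eta>)"
      for x y :: "'r \<times> 'c \<Rightarrow> int"
    define w where "w = 2 * \<eta> / (2 ^ e * X q)"
    have w0: "0 \<le> w" using \<eta> X0[OF pq(2)] by (simp add: w_def)
    have "(\<Sum>k\<in>?K. t p q e k) \<le> (\<Sum>k\<in>?K. if C (restrict k ?P) then w * V (restrict k ?P) (restrict k ?Q) else 0)"
    proof (rule sum_mono)
      fix k
      have "V (restrict k ?P) (restrict k ?Q) = slab_vol ?I ?J (eliminate (?a k) p q) (2 * \<eta>)"
        unfolding V_def by (rule slab_vol_cong) (use pq in \<open>auto simp: off'_def eliminate_def\<close>)
      moreover have "C (restrict k ?P)" if "pivot_cond I J X E (?a k) p q e"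
        using that pq unfolding C_def pivot_cond_def by auto
      ultimately show "t p q e k \<le> (if C (restrict k ?P) then w * V (restrict k ?P) (restrict k ?Q) else 0)"
        unfolding t_def w_def[symmetric] using w0 by auto
    qed
    also have "\<dots> = (\<Sum>x\<in>PiE ?P ?F. \<Sum>y\<in>PiE ?Q ?F. if C x then w * V x y else 0)"
      unfolding PQ(2) by (rule sum_PiE_Un[OF PQ(1)])
    also have "\<dots> = (\<Sum>x\<in>PiE ?P ?F. if C x then w * (\<Sum>y\<in>PiE ?Q ?F. V x y) else 0)"
      by (intro sum.cong refl) (simp add: sum_distrib_left)
    finally have 1: "(\<Sum>k\<in>?K. t p q e k) \<le> (\<Sum>x\<in>PiE ?P ?F. if C x then w * (\<Sum>y\<in>PiE ?Q ?F. V x y) else 0)" .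
    have PXq: "?PX = X q * (\<Prod>j\<in>?J. X j)" by (rule prod.remove[OF fin(2) pq(2)])
    have IH: "(\<Prod>j\<in>?J. X j) * (\<Sum>y\<in>PiE ?Q ?F. V x y) \<le> pivot_bound \<kappa> E m n (2 * \<eta>)" for x
      unfolding V_def by (rule 3(1)) (use fin pq cI cJ \<eta> \<kappa> finB X1 XE cB cW in auto)
    have wX: "w * X q = 2 * \<eta> / 2 ^ e" using X0[OF pq(2)] by (simp add: w_def)
    have "?PX * (\<Sum>k\<in>?K. t p q e k) \<le> ?PX * (\<Sum>x\<in>PiE ?P ?F. if C x then w * (\<Sum>y\<in>PiE ?Q ?F. V x y) else 0)"
      by (intro mult_left_mono 1 PX0)
    also have "\<dots> = (\<Sum>x\<in>PiE ?P ?F. if C x then w * X q * ((\<Prod>j\<in>?J. X j) * (\<Sum>y\<in>PiE ?Q ?F. V x y)) else 0)"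
      by (subst sum_distrib_left, intro sum.cong refl) (simp add: PXq mult_ac)
    also have "\<dots> \<le> (\<Sum>x\<in>PiE ?P ?F. if C x then 2 * \<eta> / 2 ^ e * pivot_bound \<kappa> E m n (2 * \<eta>) else 0)"
      unfolding wX using IH \<eta> by (intro sum_mono) (auto intro!: mult_left_mono divide_right_mono)
    also have "\<dots> = real (card {x \<in> PiE ?P ?F. C x}) * (2 * \<eta> / 2 ^ e * pivot_bound \<kappa> E m n (2 * \<eta>))"
      using finP finB pq by (subst sum.inter_filter[symmetric]) (auto intro!: finite_PiE)
    also have "\<dots> \<le> (\<kappa> * 2 ^ Suc e) ^ (m + n + 1) * (2 * \<eta> / 2 ^ e * pivot_bound \<kappa> E m n (2 * \<eta>))"
    proof (rule mult_right_mono)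
      have "{x \<in> PiE ?P ?F. C x} = PiE ?P (\<lambda>(i, j). {k \<in> B j. e < E \<longrightarrow> \<bar>(real_of_int k)\<^sup>2 - off i j\<bar> \<le> 2 ^ Suc e * X j})"
        unfolding C_def by (auto simp: PiE_iff extensional_def)
      also have "real (card \<dots>) \<le> (\<kappa> * 2 ^ Suc e) ^ card ?P"
      proof (rule card_PiE_le_power[OF finP], clarify)
        fix i j assume "(i, j) \<in> ?P"
        then have j: "j \<in> J" using pq by auto
        show "real (card {k \<in> B j. e < E \<longrightarrow> \<bar>(real_of_int k)\<^sup>2 - off i j\<bar> \<le> 2 ^ Suc e * X j}) \<le> \<kappa> * 2 ^ Suc e"
        proof (cases "e < E")
          case True
          then show ?thesis using cW[OF j, of "2 ^ Suc e" "off i j"] one_le_power[of "2 :: real" "Suc e"] by simp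
        next
          case False
          \<comment> \<open>In the open-ended class the whole box is counted, which costs no more than a window.\<close>
          then have "e = E" using e by simp
          then have "\<kappa> * X j \<le> \<kappa> * 2 ^ Suc e" using \<kappa> by (intro mult_left_mono order_trans[OF XE[OF j]]) auto
          with cB[OF j] False show ?thesis by auto
        qed
      qed
      finally show "real (card {x \<in> PiE ?P ?F. C x}) \<le> (\<kappa> * 2 ^ Suc e) ^ (m + n + 1)" unfolding cP .
      show "0 \<le> 2 * \<eta> / 2 ^ e * pivot_bound \<kappa> E m n (2 * \<eta>)"
        using \<eta> \<kappa> by (intro mult_nonneg_nonneg pivot_bound_nonneg) auto
    qed
    also have "\<dots> = (2 * \<kappa>) ^ (m + n + 1) * (2 * \<eta>) * (2 ^ e) ^ (m + n) * pivot_bound \<kappa> E m n (2 * \<eta>)"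
      by (simp add: power_mult_distrib field_simps)
    also have "\<dots> \<le> (2 * \<kappa>) ^ (m + n + 1) * (2 * \<eta>) * ?R ^ (m + n) * pivot_bound \<kappa> E m n (2 * \<eta>)"
      using e \<eta> \<kappa> by (intro mult_right_mono mult_left_mono power_mono power_increasing mult_nonneg_nonneg pivot_bound_nonneg) auto
    finally show ?thesis .
  qed
  have "?PX * (\<Sum>k\<in>?K. slab_vol I J (?a k) \<eta>)
      \<le> ?PX * (\<Sum>k\<in>?K. (if low k then 1 else 0) + (\<Sum>p\<in>I. \<Sum>q\<in>J. \<Sum>e\<le>E. t p q e k))"
    unfolding low_def t_def by (intro mult_left_mono sum_mono PX0 slab_vol_pivot_step fin X0 \<eta>)
  also have "\<dots> = ?PX * (\<Sum>k\<in>?K. if low k then 1 else 0) + (\<Sum>p\<in>I. \<Sum>q\<in>J. \<Sum>e\<le>E. ?PX * (\<Sum>k\<in>?K. t p q e k))"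
    by (simp add: sum.distrib sum.swap[of _ ?K] distrib_left sum_distrib_left)
  also have "\<dots> \<le> ?R ^ Suc n * \<kappa> ^ (Suc m * Suc n) + (\<Sum>p\<in>I. \<Sum>q\<in>J. \<Sum>e\<le>E.
       (2 * \<kappa>) ^ (m + n + 1) * (2 * \<eta>) * ?R ^ (m + n) * pivot_bound \<kappa> E m n (2 * \<eta>))"
  proof (rule add_mono)
    show "?PX * (\<Sum>k\<in>?K. if low k then 1 else 0) \<le> ?R ^ Suc n * \<kappa> ^ (Suc m * Suc n)"
      by (rule mult_mono[OF PXR low]) (auto intro: sum_nonneg)
  qed (intro sum_mono term_le, auto)
  also have "\<dots> = pivot_bound \<kappa> E (Suc m) (Suc n) \<eta>"
    using cI cJ by (simp add: algebra_simps)
  finally show ?case .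
qed

section \<open>The moment sum\<close>

text \<open>
  For \<open>m = b - 1\<close> and \<open>n = d\<close>, the term of index \<open>r\<close> is \<open>1 / \<delta>\<close> times the term \<open>b\<^sub>2 = r + 1\<close> of the
  maximum in the definition of \<open>moment_bound\<close>.  The term \<open>b\<^sub>2 = 0\<close> has no counterpart.
\<close>

definition moment_sum :: "nat \<Rightarrow> nat \<Rightarrow> real \<Rightarrow> real \<Rightarrow> real" where
  "moment_sum m n \<delta> \<Lambda> = (\<Sum>r\<le>min m n. \<delta> ^ r * \<Lambda> powr (real n + real r * real (m + n) - real r * (real r + 1)))"

lemma moment_exponent_nonneg:
  assumes "r \<le> min m n"
  shows "0 \<le> real n + real r * real (m + n) - real r * (real r + 1)"
proof (cases r)
  case (Suc s)
  have "real r * (real r + 1) \<le> real r * real (m + n)"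
    using assms Suc by (intro mult_left_mono) auto
  then show ?thesis by simp
qed simp

lemma moment_sum_nonneg: "0 \<le> \<delta> \<Longrightarrow> 0 \<le> moment_sum m n \<delta> \<Lambda>"
  unfolding moment_sum_def by (intro sum_nonneg) auto

lemma moment_sum_ge: "0 \<le> \<delta> \<Longrightarrow> \<Lambda> powr real n \<le> moment_sum m n \<delta> \<Lambda>"
  unfolding moment_sum_def
  using member_le_sum[of 0 "{..min m n}" "\<lambda>r. \<delta> ^ r * \<Lambda> powr (real n + real r * real (m + n) - real r * (real r + 1))"]
  by auto

text \<open>
  Since all exponents are nonnegative, a bounded change of scale changes the moment sum by a bounded
  factor.  It is used to replace \<open>\<Lambda>\<close> and \<open>\<delta>\<close> by powers of 2.
\<close>

lemma moment_sum_mono_scale: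
  assumes c: "1 \<le> c"
  obtains C where "0 < C" "\<And>\<delta> \<delta>' \<Lambda> \<Lambda>'. 0 \<le> \<delta> \<Longrightarrow> \<delta> \<le> c * \<delta>' \<Longrightarrow> 0 < \<Lambda> \<Longrightarrow> \<Lambda> \<le> c * \<Lambda>' \<Longrightarrow>
    moment_sum m n \<delta> \<Lambda> \<le> C * moment_sum m n \<delta>' \<Lambda>'"
proof -
  let ?e = "\<lambda>r. real n + real r * real (m + n) - real r * (real r + 1)"
  define C where "C = Max ((\<lambda>r. c ^ r * c powr ?e r) ` {..min m n})"
  have C: "c ^ r * c powr ?e r \<le> C" if "r \<le> min m n" for r
    unfolding C_def using that by (intro Max_ge finite_imageI imageI) auto
  have "0 < c ^ 0 * c powr ?e 0" using c by simp
  then have "0 < C" using C[of 0] by linarith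
  moreover
  have "moment_sum m n \<delta> \<Lambda> \<le> C * moment_sum m n \<delta>' \<Lambda>'"
    if h: "0 \<le> \<delta>" "\<delta> \<le> c * \<delta>'" "0 < \<Lambda>" "\<Lambda> \<le> c * \<Lambda>'" for \<delta> \<delta>' \<Lambda> \<Lambda>'
    unfolding moment_sum_def sum_distrib_left
  proof (rule sum_mono)
    fix r assume r: "r \<in> {..min m n}"
    have d: "0 \<le> \<delta>'" using order_trans[OF h(1,2)] c by (simp add: zero_le_mult_iff)
    have L: "0 < \<Lambda>'" using less_le_trans[OF h(3,4)] c by (simp add: zero_less_mult_iff)
    have "\<delta> ^ r * \<Lambda> powr ?e r \<le> (c * \<delta>') ^ r * (c * \<Lambda>') powr ?e r"
      using h moment_exponent_nonneg[of r m n] r by (intro mult_mono power_mono powr_mono2) auto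
    also have "\<dots> = (c ^ r * c powr ?e r) * (\<delta>' ^ r * \<Lambda>' powr ?e r)"
      using c L by (simp add: power_mult_distrib powr_mult)
    also have "\<dots> \<le> C * (\<delta>' ^ r * \<Lambda>' powr ?e r)"
      using C[of r] r d by (intro mult_right_mono) auto
    finally show "\<delta> ^ r * \<Lambda> powr ?e r \<le> C * (\<delta>' ^ r * \<Lambda>' powr ?e r)" .
  qed
  ultimately show thesis using that by blast
qed

text \<open>
  One elimination step turns the term of index \<open>r\<close> for \<open>(m, n)\<close> into the term of index \<open>Suc r\<close> for
  \<open>(Suc m, Suc n)\<close>.
\<close>

lemma moment_sum_step:
  assumes "0 \<le> \<delta>" "1 \<le> \<Lambda>"
  shows "\<delta> * \<Lambda> powr (real (m + n) + 1) * moment_sum m n \<delta> \<Lambda> \<le> moment_sum (Suc m) (Suc n) \<delta> \<Lambda>"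
proof -
  let ?f = "\<lambda>r. \<delta> ^ r * \<Lambda> powr (real (Suc n) + real r * real (Suc m + Suc n) - real r * (real r + 1))"
  have "\<delta> * \<Lambda> powr (real (m + n) + 1) * moment_sum m n \<delta> \<Lambda> = (\<Sum>r\<le>min m n. ?f (Suc r))"
    unfolding moment_sum_def sum_distrib_left
  proof (intro sum.cong refl)
    fix r
    have "real (m + n) + 1 + (real n + real r * real (m + n) - real r * (real r + 1))
        = real (Suc n) + real (Suc r) * real (Suc m + Suc n) - real (Suc r) * (real (Suc r) + 1)"
      by (simp add: algebra_simps)
    then have "\<Lambda> powr (real (m + n) + 1) * \<Lambda> powr (real n + real r * real (m + n) - real r * (real r + 1))
        = \<Lambda> powr (real (Suc n) + real (Suc r) * real (Suc m + Suc n) - real (Suc r) * (real (Suc r) + 1))"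
      by (simp only: flip: powr_add)
    then show "\<delta> * \<Lambda> powr (real (m + n) + 1) * (\<delta> ^ r * \<Lambda> powr (real n + real r * real (m + n) - real r * (real r + 1))) = ?f (Suc r)"
      by (simp only: power_Suc mult.assoc mult.left_commute[of "\<Lambda> powr (real (m + n) + 1)"])
  qed
  also have "\<dots> = (\<Sum>r\<in>Suc ` {..min m n}. ?f r)" by (simp add: sum.reindex)
  also have "\<dots> \<le> (\<Sum>r\<le>min (Suc m) (Suc n). ?f r)"
    using assms by (intro sum_mono2) auto
  finally show ?thesis by (simp add: moment_sum_def)
qed

text \<open>
  In the unfolded recursion the terms are indexed by the number \<open>r\<close> of pivots that are used, and each
  pivot contributes the number \<open>Suc E\<close> of dyadic classes.
\<close>

lemma pivot_bound_le:
  assumes \<kappa>: "1 \<le> \<kappa>"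
  shows "\<exists>C>0. \<forall>E \<eta>. 0 \<le> \<eta> \<longrightarrow> pivot_bound \<kappa> E m n \<eta> \<le> C * real (Suc E) ^ m * moment_sum m n (\<eta> / 2 ^ E) (2 ^ E)"
proof (induction m arbitrary: n)
  case 0
  show ?case
    by (rule exI[of _ 1]) (simp add: moment_sum_def powr_realpow)
next
  case (Suc m)
  show ?case
  proof (cases n)
    case 0
    have "1 \<le> real (Suc E) ^ Suc m" for E by (intro one_le_power) simp
    then show ?thesis unfolding 0 by (intro exI[of _ 1]) (simp add: moment_sum_def)
  next
    case (Suc n')
    obtain C where C: "0 < C" "\<And>E \<eta>. 0 \<le> \<eta> \<Longrightarrow>
        pivot_bound \<kappa> E m n' \<eta> \<le> C * real (Suc E) ^ m * moment_sum m n' (\<eta> / 2 ^ E) (2 ^ E)"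
      using Suc.IH[of n'] by blast
    obtain D where D: "0 < D" "\<And>\<delta> \<delta>' \<Lambda> \<Lambda>'. 0 \<le> \<delta> \<Longrightarrow> \<delta> \<le> 2 * \<delta>' \<Longrightarrow> 0 < \<Lambda> \<Longrightarrow> \<Lambda> \<le> 2 * \<Lambda>' \<Longrightarrow>
        moment_sum m n' \<delta> \<Lambda> \<le> D * moment_sum m n' \<delta>' \<Lambda>'"
      by (rule moment_sum_mono_scale[where c = 2 and m = m and n = n']) auto
    define K1 where "K1 = \<kappa> ^ (Suc m * Suc n')"
    define K2 where "K2 = real (Suc m * Suc n') * (2 * \<kappa>) ^ (m + n' + 1) * 2 * C * D"
    have "0 < real (Suc m * Suc n')" by (simp only: of_nat_0_less_iff) simp
    then have K: "0 < K1" "0 < K2"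
      unfolding K1_def K2_def using \<kappa> C(1) D(1) by (intro mult_pos_pos zero_less_power; linarith)+
    have "pivot_bound \<kappa> E (Suc m) n \<eta> \<le> (K1 + K2) * real (Suc E) ^ Suc m * moment_sum (Suc m) n (\<eta> / 2 ^ E) (2 ^ E)"
      if \<eta>: "0 \<le> \<eta>" for E \<eta>
    proof -
      define R where "R = (2 ^ E :: real)"
      have R: "1 \<le> R" by (simp add: R_def)
      define L where "L = real (Suc E)"
      have L: "1 \<le> L" by (simp add: L_def)
      define M where "M = moment_sum (Suc m) (Suc n') (\<eta> / R) R"
      have M0: "R ^ Suc n' \<le> M"
        unfolding M_def using moment_sum_ge[of "\<eta> / R" R "Suc n'" "Suc m"] \<eta> R powr_realpow[of R "Suc n'"] by (simp del: power_Suc of_nat_Suc)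
      have Mpos: "0 \<le> M" unfolding M_def by (rule moment_sum_nonneg) (use \<eta> R in auto)
      have "K1 * R ^ Suc n' \<le> K1 * L ^ Suc m * M"
      proof -
        have "R ^ Suc n' \<le> 1 * M" using M0 by simp
        also have "\<dots> \<le> L ^ Suc m * M" using Mpos L by (intro mult_right_mono one_le_power) auto
        finally show ?thesis using K by (simp add: mult.assoc)
      qed
      moreover have "real (Suc m * Suc n' * Suc E) * (2 * \<kappa>) ^ (m + n' + 1) * (2 * \<eta>) * R ^ (m + n') * pivot_bound \<kappa> E m n' (2 * \<eta>)
          \<le> K2 * L ^ Suc m * M"
      proof -
        have s: "moment_sum m n' (2 * \<eta> / R) R \<le> D * moment_sum m n' (\<eta> / R) R"
          using \<eta> R by (intro D(2)) auto
        have "\<eta> * R ^ (m + n') * moment_sum m n' (\<eta> / R) R = (\<eta> / R) * R powr (real (m + n') + 1) * moment_sum m n' (\<eta> / R) R"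
          using R powr_realpow[of R "m + n'"] by (simp add: powr_add del: of_nat_add)
        also have "\<dots> \<le> M" unfolding M_def using \<eta> R by (intro moment_sum_step) auto
        finally have st: "\<eta> * R ^ (m + n') * moment_sum m n' (\<eta> / R) R \<le> M" .
        have "pivot_bound \<kappa> E m n' (2 * \<eta>) \<le> C * L ^ m * moment_sum m n' (2 * \<eta> / R) R"
          using C(2)[of "2 * \<eta>" E] \<eta> by (simp add: L_def R_def)
        also have "\<dots> \<le> C * L ^ m * (D * moment_sum m n' (\<eta> / R) R)"
          using C(1) L by (intro mult_left_mono s) auto
        finally have "real (Suc m * Suc n' * Suc E) * (2 * \<kappa>) ^ (m + n' + 1) * (2 * \<eta>) * R ^ (m + n') * pivot_bound \<kappa> E m n' (2 * \<eta>)
           \<le> real (Suc m * Suc n' * Suc E) * (2 * \<kappa>) ^ (m + n' + 1) * (2 * \<eta>) * R ^ (m + n') * (C * L ^ m * (D * moment_sum m n' (\<eta> / R) R))"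
          using \<eta> \<kappa> R by (intro mult_left_mono mult_nonneg_nonneg zero_le_power of_nat_0_le_iff) linarith+
        also have "\<dots> = K2 * L ^ Suc m * (\<eta> * R ^ (m + n') * moment_sum m n' (\<eta> / R) R)"
          unfolding K2_def of_nat_mult L_def[symmetric] power_Suc by (simp only: mult_ac)
        also have "\<dots> \<le> K2 * L ^ Suc m * M" using K L by (intro mult_left_mono st) auto
        finally show ?thesis .
      qed
      ultimately have "pivot_bound \<kappa> E (Suc m) (Suc n') \<eta> \<le> K1 * L ^ Suc m * M + K2 * L ^ Suc m * M"
        unfolding pivot_bound.simps K1_def R_def by (rule add_mono)
      then show ?thesis unfolding Suc M_def R_def L_def by (simp only: distrib_right)
    qed
    then show ?thesis using K by (intro exI[of _ "K1 + K2"]) auto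
  qed
qed

section \<open>Dyadic boxes\<close>

text \<open>
  Adding 1 to \<open>\<bar>k\<bar>\<close> puts \<open>k = 0\<close> into the box \<open>e = 0\<close>.
\<close>

definition dyadic_box :: "nat \<Rightarrow> int set" where
  "dyadic_box e = {k. 2 ^ e \<le> \<bar>k\<bar> + 1 \<and> \<bar>k\<bar> + 1 < 2 ^ Suc e}"

lemma finite_dyadic_box: "finite (dyadic_box e)"
  by (rule finite_subset[of _ "{- (2 ^ Suc e)..2 ^ Suc e}"]) (auto simp: dyadic_box_def)

lemma card_dyadic_box: "real (card (dyadic_box e)) \<le> 6 * 2 ^ e"
proof -
  have "card (dyadic_box e) \<le> card {- (2 ^ Suc e)..(2 ^ Suc e :: int)}"
    by (rule card_mono) (auto simp: dyadic_box_def)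
  also have "\<dots> = nat (2 * 2 ^ Suc e + 1)" by simp
  finally have "int (card (dyadic_box e)) \<le> 2 * 2 ^ Suc e + 1" by (simp add: le_nat_iff)
  then have "real_of_int (int (card (dyadic_box e))) \<le> real_of_int (2 * 2 ^ Suc e + 1)" by (simp only: of_int_le_iff)
  then have "real (card (dyadic_box e)) \<le> 4 * 2 ^ e + 1" by simp
  moreover have "(1 :: real) \<le> 2 ^ e" by simp
  ultimately show ?thesis by linarith
qed

lemma dyadic_box_cover:
  assumes "real_of_int \<bar>k\<bar> + 1 < 2 ^ E"
  obtains e where "e < E" "k \<in> dyadic_box e"
proof -
  obtain e where e: "e < E" "2 ^ e \<le> real_of_int \<bar>k\<bar> + 1" "real_of_int \<bar>k\<bar> + 1 < 2 ^ Suc e"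
    using dyadic_scale[of "real_of_int \<bar>k\<bar> + 1" E] assms by auto
  then have "real_of_int (2 ^ e) \<le> real_of_int (\<bar>k\<bar> + 1)" "real_of_int (\<bar>k\<bar> + 1) < real_of_int (2 ^ Suc e)" by simp_all
  then have "k \<in> dyadic_box e" unfolding dyadic_box_def of_int_le_iff of_int_less_iff by simp
  with e show thesis using that by blast
qed

lemma card_int_diam_le:
  fixes S :: "int set"
  assumes fin: "finite S" and u: "0 \<le> u" and diam: "\<And>k l. k \<in> S \<Longrightarrow> l \<in> S \<Longrightarrow> k \<le> l \<Longrightarrow> real_of_int (l - k) \<le> u"
  shows "real (card S) \<le> u + 1"
proof (cases "S = {}")
  case False
  let ?a = "Min S" and ?b = "Max S"
  have "S \<subseteq> {?a..?b}" using fin by auto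
  then have "card S \<le> card {?a..?b}" by (rule card_mono[rotated]) simp
  moreover have "?a \<le> ?b" using fin False by simp
  ultimately have "real (card S) \<le> real_of_int (?b - ?a) + 1" by simp
  also have "\<dots> \<le> u + 1" using diam[of ?a ?b] fin False \<open>?a \<le> ?b\<close> by simp
  finally show ?thesis .
qed (use u in simp)

text \<open>
  Two different nonnegative elements \<open>k < l\<close> of the box satisfy \<open>l + k \<ge> 2 ^ e\<close> and therefore
  \<open>l\<^sup>2 - k\<^sup>2 \<ge> (l - k) * 2 ^ e\<close>.  Hence the nonnegative integers that are counted lie in an interval of
  length \<open>2 * u\<close>; the negative ones are treated by symmetry.
\<close>

lemma card_dyadic_box_window:
  assumes u: "1 \<le> u"
  shows "real (card {k \<in> dyadic_box e. \<bar>(real_of_int k)\<^sup>2 - x\<bar> \<le> u * 2 ^ e}) \<le> 6 * u"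
proof -
  define S where "S = {k \<in> dyadic_box e. \<bar>(real_of_int k)\<^sup>2 - x\<bar> \<le> u * 2 ^ e}"
  define S' where "S' = {k \<in> S. 0 \<le> k}"
  have fin: "finite S" "finite S'" using finite_dyadic_box by (auto simp: S_def S'_def)
  have "S \<subseteq> S' \<union> uminus ` S'"
  proof
    fix k assume "k \<in> S"
    then have "k \<in> S' \<or> - k \<in> S'" unfolding S'_def S_def dyadic_box_def by auto
    then show "k \<in> S' \<union> uminus ` S'" by (metis UnI1 UnI2 image_eqI minus_minus)
  qed
  then have "card S \<le> card (S' \<union> uminus ` S')" using fin by (intro card_mono) auto
  also have "\<dots> \<le> card S' + card (uminus ` S')" by (rule card_Un_le)
  also have "\<dots> \<le> card S' + card S'" using fin by (intro add_left_mono card_image_le) auto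
  finally have "real (card S) \<le> 2 * real (card S')" by simp
  also have "real (card S') \<le> 2 * u + 1"
  proof (rule card_int_diam_le[OF fin(2)])
    fix k l assume kl: "k \<in> S'" "l \<in> S'" "k \<le> l"
    show "real_of_int (l - k) \<le> 2 * u"
    proof (cases "k = l")
      case False
      have "(2 :: int) ^ e \<le> k + 1" "0 \<le> k" "k < l" using kl False by (auto simp: S'_def S_def dyadic_box_def)
      then have "(2 :: int) ^ e \<le> l + k" by linarith
      then have "real_of_int (2 ^ e) \<le> real_of_int (l + k)" by (simp only: of_int_le_iff)
      then have X: "2 ^ e \<le> real_of_int (l + k)" by simp
      have "real_of_int (l - k) * 2 ^ e \<le> real_of_int (l - k) * real_of_int (l + k)"
        using X kl by (intro mult_left_mono) auto
      also have "\<dots> = (real_of_int l)\<^sup>2 - (real_of_int k)\<^sup>2" by (simp add: power2_eq_square algebra_simps)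
      also have "\<dots> \<le> 2 * u * 2 ^ e"
      proof -
        have "\<bar>(real_of_int k)\<^sup>2 - x\<bar> \<le> u * 2 ^ e" "\<bar>(real_of_int l)\<^sup>2 - x\<bar> \<le> u * 2 ^ e"
          using kl by (auto simp: S'_def S_def)
        then show ?thesis by linarith
      qed
      finally show ?thesis by simp
    qed (use u in simp)
  qed (use u in simp)
  finally show ?thesis using u by (simp add: S_def)
qed

section \<open>Averaging over the diagonal coefficients\<close>

definition lattice_box :: "nat \<Rightarrow> (nat \<Rightarrow> nat) \<Rightarrow> (nat \<Rightarrow> int) set" where
  "lattice_box d e = PiE {1..d} (\<lambda>j. dyadic_box (e j))"

text \<open>
  The values of \<open>q\<close> are compared with each other and not with a given number.  For this reason one count
  serves all shells of the same order of magnitude, see \<open>card_power_le_close_tuples\<close>.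
\<close>

definition close_tuples :: "nat \<Rightarrow> nat \<Rightarrow> ((nat \<Rightarrow> int) \<Rightarrow> real) \<Rightarrow> (nat \<Rightarrow> nat) \<Rightarrow> real \<Rightarrow> nat" where
  "close_tuples d m q e \<eta> =
     (\<Sum>k\<in>lattice_box d e. card {t \<in> PiE {..<m} (\<lambda>_. lattice_box d e). \<forall>i<m. \<bar>q (t i) - q k\<bar> \<le> \<eta>})"

lemma finite_lattice_box: "finite (lattice_box d e)"
  unfolding lattice_box_def by (intro finite_PiE finite_dyadic_box) auto

lemma card_lattice_box: "real (card (lattice_box d e)) \<le> 6 ^ d * (\<Prod>j=1..d. 2 ^ e j)"
proof -
  have "real (card (lattice_box d e)) = (\<Prod>j=1..d. real (card (dyadic_box (e j))))"
    by (simp add: lattice_box_def card_PiE)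
  also have "\<dots> \<le> (\<Prod>j=1..d. 6 * 2 ^ e j)"
    by (intro prod_mono) (auto simp: card_dyadic_box)
  finally show ?thesis by (simp add: prod.distrib)
qed

text \<open>
  A family of quadratic forms \<open>Q w\<close>, where the coordinate \<open>c \<in> J\<close> of the parameter \<open>w\<close> is the diagonal
  coefficient with index \<open>\<iota> c\<close>, and the part \<open>off\<close> is unaffected by these coordinates.  With \<open>J = K\<close> the
  off-diagonal coefficients are fixed; with a larger \<open>K\<close> they are parameters as well.
\<close>

locale diagonal_family =
  fixes K J :: "'c set" and \<iota> :: "'c \<Rightarrow> nat" and d :: nat
    and Q off :: "('c \<Rightarrow> real) \<Rightarrow> (nat \<Rightarrow> int) \<Rightarrow> real"
  assumes finite_K: "finite K" and J_subset: "J \<subseteq> K" and \<iota>_bij: "bij_betw \<iota> J {1..d}"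
    and Q_eq: "\<And>w k. Q w k = (\<Sum>c\<in>J. w c * (real_of_int (k (\<iota> c)))\<^sup>2) + off w k"
    and off_cong: "\<And>w w' k. (\<And>c. c \<in> K - J \<Longrightarrow> w c = w' c) \<Longrightarrow> off w k = off w' k"
    and off_measurable: "\<And>k. (\<lambda>w. off w k) \<in> borel_measurable (Pi\<^sub>M K (\<lambda>_. lborel))"
begin

definition region :: "('c \<Rightarrow> real) set" where
  "region = PiE K (\<lambda>c. if c \<in> J then {1..2} else {- 1..1})"

lemma finite_J: "finite J"
  using finite_K J_subset by (rule finite_subset[rotated])

lemma region_sets [measurable]: "region \<in> sets (Pi\<^sub>M K (\<lambda>_. lborel))"
  unfolding region_def using finite_K by (intro sets_PiM_I_finite) auto

lemma Q_measurable [measurable]: "(\<lambda>w. Q w k) \<in> borel_measurable (Pi\<^sub>M K (\<lambda>_. lborel))"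
  unfolding Q_eq using J_subset off_measurable
  by (intro borel_measurable_add borel_measurable_sum borel_measurable_times measurable_const off_measurable) auto

text \<open>
  For fixed coordinates outside \<open>J\<close> the conditions define a slab in the diagonal coefficients, so the
  bound for slabs can be integrated over the remaining coordinates, which fill a cube of side 2.
\<close>

lemma emeasure_close_le:
  assumes "finite I"
  shows "emeasure (Pi\<^sub>M K (\<lambda>_. lborel)) {w \<in> region. \<forall>i\<in>I. \<bar>Q w (t i) - Q w k\<bar> \<le> \<eta>}
    \<le> ennreal (2 ^ card (K - J) *
        slab_vol I J (\<lambda>i c. (real_of_int (t i (\<iota> c)))\<^sup>2 - (real_of_int (k (\<iota> c)))\<^sup>2) \<eta>)"
proof -
  interpret product_sigma_finite "\<lambda>_::'c. lborel :: real measure" by (rule product_lborel)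
  let ?a = "\<lambda>i c. (real_of_int (t i (\<iota> c)))\<^sup>2 - (real_of_int (k (\<iota> c)))\<^sup>2"
  let ?S = "{w \<in> region. \<forall>i\<in>I. \<bar>Q w (t i) - Q w k\<bar> \<le> \<eta>}"
  let ?O = "K - J"
  let ?c = "\<lambda>x i. off x (t i) - off x k"
  let ?B = "PiE ?O (\<lambda>_. {- 1..1::real})"
  have K: "?O \<union> J = K" "?O \<inter> J = {}" using J_subset by auto
  have "?S = region \<inter> {w \<in> space (Pi\<^sub>M K (\<lambda>_. lborel)). \<forall>i\<in>I. \<bar>Q w (t i) - Q w k\<bar> \<le> \<eta>}"
    using sets.sets_into_space[OF region_sets] by auto
  also have "\<dots> \<in> sets (Pi\<^sub>M K (\<lambda>_. lborel))"
    using assms by measurable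
  finally have S: "?S \<in> sets (Pi\<^sub>M K (\<lambda>_. lborel))" .
  have ind: "indicator ?S (merge ?O J (x, y)) \<le> (indicator ?B x * indicator (slab I J ?a (?c x) \<eta>) y :: ennreal)"
    if x: "x \<in> space (Pi\<^sub>M ?O (\<lambda>_. lborel))" and y: "y \<in> space (Pi\<^sub>M J (\<lambda>_. lborel))" for x y :: "'c \<Rightarrow> real"
  proof (cases "merge ?O J (x, y) \<in> ?S")
    case True
    let ?w = "merge ?O J (x, y)"
    have wO: "?w c = x c" if "c \<in> ?O" for c using that by (simp add: merge_def)
    have wJ: "?w c = y c" if "c \<in> J" for c using that by (simp add: merge_def)
    have reg: "?w c \<in> (if c \<in> J then {1..2} else {- 1..1})" if "c \<in> K" for c
    proof -
      have "?w \<in> PiE K (\<lambda>c. if c \<in> J then {1..2} else {- 1..1})" using True by (simp add: region_def)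
      then show ?thesis using that by (rule PiE_mem)
    qed
    have "x \<in> ?B"
    proof (rule PiE_I)
      show "x c \<in> {- 1..1}" if "c \<in> ?O" for c using reg[of c] wO[OF that] that by simp
      show "x c = undefined" if "c \<notin> ?O" for c
        using x that by (auto simp: space_PiM PiE_iff extensional_def)
    qed
    moreover have "y \<in> slab I J ?a (?c x) \<eta>"
      unfolding slab_def
    proof (intro CollectI conjI ballI)
      show "y \<in> J \<rightarrow>\<^sub>E {1..2}"
      proof (rule PiE_I)
        show "y c \<in> {1..2}" if "c \<in> J" for c using reg[of c] wJ[OF that] that J_subset by auto
        show "y c = undefined" if "c \<notin> J" for c
          using y that by (auto simp: space_PiM PiE_iff extensional_def)
      qed
      fix i assume i: "i \<in> I"
      have o: "off ?w l = off x l" for l by (rule off_cong) (rule wO)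
      have "Q ?w l = (\<Sum>c\<in>J. y c * (real_of_int (l (\<iota> c)))\<^sup>2) + off x l" for l
        unfolding Q_eq o by (simp add: wJ cong: sum.cong)
      then have "(\<Sum>c\<in>J. ?a i c * y c) + ?c x i = Q ?w (t i) - Q ?w k"
        by (simp add: algebra_simps sum_subtractf)
      then show "\<bar>(\<Sum>c\<in>J. ?a i c * y c) + ?c x i\<bar> \<le> \<eta>" using True i by auto
    qed
    ultimately show ?thesis using True by simp
  qed simp
  have meas: "(indicator ?S :: _ \<Rightarrow> ennreal) \<in> borel_measurable (Pi\<^sub>M (?O \<union> J) (\<lambda>_. lborel))"
    unfolding K using S by simp
  have fin: "finite ?O" using finite_K by simp
  have B: "?B \<in> sets (Pi\<^sub>M ?O (\<lambda>_. lborel))" by (rule box_sets[OF fin])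
  have "emeasure (Pi\<^sub>M K (\<lambda>_. lborel)) ?S = (\<integral>\<^sup>+w. indicator ?S w \<partial>Pi\<^sub>M K (\<lambda>_. lborel))"
    using S by simp
  also have "\<dots> = (\<integral>\<^sup>+x. (\<integral>\<^sup>+y. indicator ?S (merge ?O J (x, y)) \<partial>Pi\<^sub>M J (\<lambda>_. lborel)) \<partial>Pi\<^sub>M ?O (\<lambda>_. lborel))"
    using product_nn_integral_fold[OF K(2) fin finite_J meas] unfolding K(1) .
  also have "\<dots> \<le> (\<integral>\<^sup>+x. ennreal (slab_vol I J ?a \<eta>) * indicator ?B x \<partial>Pi\<^sub>M ?O (\<lambda>_. lborel))"
  proof (rule nn_integral_mono)
    fix x :: "'c \<Rightarrow> real" assume x: "x \<in> space (Pi\<^sub>M ?O (\<lambda>_. lborel))"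
    have "(\<integral>\<^sup>+y. indicator ?S (merge ?O J (x, y)) \<partial>Pi\<^sub>M J (\<lambda>_. lborel))
        \<le> (\<integral>\<^sup>+y. indicator ?B x * indicator (slab I J ?a (?c x) \<eta>) y \<partial>Pi\<^sub>M J (\<lambda>_. lborel))"
      by (intro nn_integral_mono ind x)
    also have "\<dots> = indicator ?B x * emeasure (Pi\<^sub>M J (\<lambda>_. lborel)) (slab I J ?a (?c x) \<eta>)"
      by (rule nn_integral_cmult_indicator) (rule slab_sets[OF assms finite_J])
    also have "\<dots> \<le> indicator ?B x * ennreal (slab_vol I J ?a \<eta>)"
      by (intro mult_left_mono emeasure_slab_le finite_J) simp
    finally show "(\<integral>\<^sup>+y. indicator ?S (merge ?O J (x, y)) \<partial>Pi\<^sub>M J (\<lambda>_. lborel)) \<le> ennreal (slab_vol I J ?a \<eta>) * indicator ?B x"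
      by (simp add: mult.commute)
  qed
  also have "\<dots> = ennreal (slab_vol I J ?a \<eta>) * emeasure (Pi\<^sub>M ?O (\<lambda>_. lborel)) ?B"
    by (rule nn_integral_cmult_indicator[OF B])
  also have "emeasure (Pi\<^sub>M ?O (\<lambda>_. lborel)) ?B = (\<Prod>c\<in>?O. emeasure lborel {- 1..1::real})"
    by (rule emeasure_PiM) (auto simp: fin)
  also have "\<dots> = ennreal (2 ^ card ?O)"
    by (simp add: ennreal_power[symmetric])
  finally show ?thesis by (simp add: ennreal_mult[symmetric] mult.commute)
qed

text \<open>
  Tuples of lattice points are read as integer matrices with one row for each point and one column for
  each diagonal coefficient.
\<close>

lemma sum_tuples_reindex:
  "(\<Sum>t\<in>PiE {..<m} (\<lambda>_. lattice_box d e). slab_vol {..<m} J (\<lambda>i c. (real_of_int (t i (\<iota> c)))\<^sup>2 - o' i c) \<eta>)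
   = (\<Sum>k\<in>PiE ({..<m} \<times> J) (\<lambda>(i, c). dyadic_box (e (\<iota> c))).
        slab_vol {..<m} J (\<lambda>i c. (real_of_int (k (i, c)))\<^sup>2 - o' i c) \<eta>)"
proof -
  define \<phi> where "\<phi> = the_inv_into J \<iota>"
  have inj: "inj_on \<iota> J" and img: "\<iota> ` J = {1..d}" using \<iota>_bij by (auto simp: bij_betw_def)
  have \<phi>1: "\<phi> (\<iota> c) = c" if "c \<in> J" for c unfolding \<phi>_def using inj that by (rule the_inv_into_f_f)
  have \<phi>2: "\<iota> (\<phi> j) = j" if "j \<in> {1..d}" for j unfolding \<phi>_def using inj that img by (auto intro: f_the_inv_into_f)
  have \<phi>3: "\<phi> j \<in> J" if "j \<in> {1..d}" for j unfolding \<phi>_def using inj that img by (auto intro: the_inv_into_into)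
  have \<iota>: "\<iota> c \<in> {1..d}" if "c \<in> J" for c using img that by auto
  show ?thesis
  proof (rule sum.reindex_bij_witness[where
      i = "\<lambda>k. restrict (\<lambda>i. restrict (\<lambda>j. k (i, \<phi> j)) {1..d}) {..<m}" and
      j = "\<lambda>t. restrict (\<lambda>(i, c). t i (\<iota> c)) ({..<m} \<times> J)"])
    fix t assume t: "t \<in> PiE {..<m} (\<lambda>_. lattice_box d e)"
    have ti: "t i \<in> PiE {1..d} (\<lambda>j. dyadic_box (e j))" if "i < m" for i
      using t that by (auto simp: lattice_box_def)
    show "(\<lambda>i\<in>{..<m}. \<lambda>j\<in>{1..d}. (\<lambda>(i, c)\<in>{..<m} \<times> J. t i (\<iota> c)) (i, \<phi> j)) = t"
    proof
      fix i
      show "(\<lambda>i\<in>{..<m}. \<lambda>j\<in>{1..d}. (\<lambda>(i, c)\<in>{..<m} \<times> J. t i (\<iota> c)) (i, \<phi> j)) i = t i"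
      proof (cases "i < m")
        case True
        have "(\<lambda>j\<in>{1..d}. (\<lambda>(i, c)\<in>{..<m} \<times> J. t i (\<iota> c)) (i, \<phi> j)) = t i"
          by (rule PiE_ext[OF _ ti[OF True]]) (use True ti[OF True] \<phi>2 \<phi>3 in \<open>auto simp: PiE_iff\<close>)
        then show ?thesis using True by simp
      next
        case False
        then show ?thesis using t by (auto simp: PiE_iff extensional_def)
      qed
    qed
    show "(\<lambda>(i, c)\<in>{..<m} \<times> J. t i (\<iota> c)) \<in> PiE ({..<m} \<times> J) (\<lambda>(i, c). dyadic_box (e (\<iota> c)))"
      using ti \<iota> by (auto simp: PiE_iff)
    show "slab_vol {..<m} J (\<lambda>i c. (real_of_int ((\<lambda>(i, c)\<in>{..<m} \<times> J. t i (\<iota> c)) (i, c)))\<^sup>2 - o' i c) \<eta>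
        = slab_vol {..<m} J (\<lambda>i c. (real_of_int (t i (\<iota> c)))\<^sup>2 - o' i c) \<eta>"
      by (rule slab_vol_cong) simp
  next
    fix k assume k: "k \<in> PiE ({..<m} \<times> J) (\<lambda>(i, c). dyadic_box (e (\<iota> c)))"
    show "(\<lambda>(i, c)\<in>{..<m} \<times> J. (\<lambda>i\<in>{..<m}. \<lambda>j\<in>{1..d}. k (i, \<phi> j)) i (\<iota> c)) = k"
    proof
      fix z
      show "(\<lambda>(i, c)\<in>{..<m} \<times> J. (\<lambda>i\<in>{..<m}. \<lambda>j\<in>{1..d}. k (i, \<phi> j)) i (\<iota> c)) z = k z"
        using k \<iota> \<phi>1 by (cases z; cases "z \<in> {..<m} \<times> J") (auto simp: PiE_iff extensional_def)
    qed
    show "(\<lambda>i\<in>{..<m}. \<lambda>j\<in>{1..d}. k (i, \<phi> j)) \<in> PiE {..<m} (\<lambda>_. lattice_box d e)"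
      unfolding lattice_box_def using k \<phi>2 \<phi>3 by (fastforce simp: PiE_iff)
  qed
qed

lemma close_tuples_eq_sum:
  "real (close_tuples d m q e \<eta>) = (\<Sum>k\<in>lattice_box d e. \<Sum>t\<in>PiE {..<m} (\<lambda>_. lattice_box d e).
      if \<forall>i<m. \<bar>q (t i) - q k\<bar> \<le> \<eta> then 1 else 0)"
proof -
  have "finite (PiE {..<m} (\<lambda>_. lattice_box d e))" by (intro finite_PiE finite_lattice_box) auto
  then show ?thesis unfolding close_tuples_def by (simp add: sum.If_cases Int_def)
qed

lemma close_tuples_measurable [measurable]:
  "(\<lambda>w. real (close_tuples d m (Q w) e \<eta>)) \<in> borel_measurable (Pi\<^sub>M K (\<lambda>_. lborel))"
  unfolding close_tuples_eq_sum
proof (intro borel_measurable_sum measurable_If measurable_const)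
  fix k and t :: "nat \<Rightarrow> nat \<Rightarrow> int"
  have "{w \<in> space (Pi\<^sub>M K (\<lambda>_. lborel)). \<forall>i\<in>{..<m}. \<bar>Q w (t i) - Q w k\<bar> \<le> \<eta>} \<in> sets (Pi\<^sub>M K (\<lambda>_. lborel))"
    by measurable
  then show "{w \<in> space (Pi\<^sub>M K (\<lambda>_. lborel)). \<forall>i<m. \<bar>Q w (t i) - Q w k\<bar> \<le> \<eta>} \<in> sets (Pi\<^sub>M K (\<lambda>_. lborel))"
    by (simp add: Ball_def)
qed simp_all

text \<open>
  The number of choices for the distinguished point is \<open>O(\<Prod>j. 2 ^ e j)\<close>, and this product is the
  factor on the left-hand side of \<open>slab_vol_sum_le\<close>.
\<close>

lemma integral_close_tuples_le:
  assumes \<eta>: "0 \<le> \<eta>" and e: "\<And>j. j \<in> {1..d} \<Longrightarrow> e j \<le> E"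
  shows "(\<integral>\<^sup>+w. ennreal (real (close_tuples d m (Q w) e \<eta>)) * indicator region w \<partial>Pi\<^sub>M K (\<lambda>_. lborel))
     \<le> ennreal (2 ^ card (K - J) * 6 ^ d * pivot_bound 6 E m d \<eta>)"
proof -
  let ?L = "lattice_box d e" and ?T = "PiE {..<m} (\<lambda>_. lattice_box d e)" and ?M = "Pi\<^sub>M K (\<lambda>_. lborel :: real measure)"
  let ?S = "\<lambda>k t. {w \<in> region. \<forall>i\<in>{..<m}. \<bar>Q w (t i) - Q w k\<bar> \<le> \<eta>}"
  let ?V = "\<lambda>k t. slab_vol {..<m} J (\<lambda>i c. (real_of_int (t i (\<iota> c)))\<^sup>2 - (real_of_int (k (\<iota> c)))\<^sup>2) \<eta>"
  let ?c = "2 ^ card (K - J) :: real"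
  have S: "?S k t \<in> sets ?M" for k t
  proof -
    have "?S k t = region \<inter> {w \<in> space ?M. \<forall>i\<in>{..<m}. \<bar>Q w (t i) - Q w k\<bar> \<le> \<eta>}"
      using sets.sets_into_space[OF region_sets] by auto
    also have "\<dots> \<in> sets ?M" by measurable
    finally show ?thesis .
  qed
  have cardJ: "card J = d" using bij_betw_same_card[OF \<iota>_bij] by simp
  have ind: "ennreal (real (close_tuples d m (Q w) e \<eta>)) * indicator region w = (\<Sum>k\<in>?L. \<Sum>t\<in>?T. indicator (?S k t) w)" for w
  proof (cases "w \<in> region")
    case True
    have "real (close_tuples d m (Q w) e \<eta>) = (\<Sum>k\<in>?L. \<Sum>t\<in>?T. indicator (?S k t) w)"
      unfolding close_tuples_eq_sum by (rule sum.cong[OF refl], rule sum.cong[OF refl]) (simp add: indicator_def True Ball_def)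
    also have "ennreal \<dots> = (\<Sum>k\<in>?L. ennreal (\<Sum>t\<in>?T. indicator (?S k t) w))"
      by (rule sum_ennreal[symmetric]) (rule sum_nonneg, simp)
    also have "\<dots> = (\<Sum>k\<in>?L. \<Sum>t\<in>?T. ennreal (indicator (?S k t) w))"
      by (rule sum.cong[OF refl], rule sum_ennreal[symmetric]) simp
    finally show ?thesis using True by (simp add: ennreal_indicator)
  next
    case False
    then have "indicator (?S k t) w = (0 :: ennreal)" for k t by simp
    then show ?thesis using False by simp
  qed
  have "(\<integral>\<^sup>+w. ennreal (real (close_tuples d m (Q w) e \<eta>)) * indicator region w \<partial>?M)
      = (\<integral>\<^sup>+w. (\<Sum>k\<in>?L. \<Sum>t\<in>?T. indicator (?S k t) w) \<partial>?M)"
    unfolding ind ..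
  also have "\<dots> = (\<Sum>k\<in>?L. \<integral>\<^sup>+w. (\<Sum>t\<in>?T. indicator (?S k t) w) \<partial>?M)"
    by (rule nn_integral_sum) (intro borel_measurable_sum borel_measurable_indicator S)
  also have "\<dots> = (\<Sum>k\<in>?L. \<Sum>t\<in>?T. \<integral>\<^sup>+w. indicator (?S k t) w \<partial>?M)"
    by (rule sum.cong[OF refl], rule nn_integral_sum) (intro borel_measurable_indicator S)
  also have "\<dots> = (\<Sum>k\<in>?L. \<Sum>t\<in>?T. emeasure ?M (?S k t))"
    by (simp only: nn_integral_indicator[OF S])
  also have "\<dots> \<le> (\<Sum>k\<in>?L. \<Sum>t\<in>?T. ennreal (?c * ?V k t))"
    by (rule sum_mono, rule sum_mono, rule emeasure_close_le) simp
  also have "\<dots> = ennreal (?c * (\<Sum>k\<in>?L. \<Sum>t\<in>?T. ?V k t))"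
    unfolding sum_distrib_left
    by (subst sum_ennreal[symmetric], (intro sum_nonneg; simp), rule sum.cong[OF refl], rule sum_ennreal) simp
  also have "\<dots> \<le> ennreal (?c * (6 ^ d * pivot_bound 6 E m d \<eta>))"
  proof (rule ennreal_leI, rule mult_left_mono)
    let ?X = "\<Prod>j=1..d. 2 ^ e j :: real"
    have X: "?X = (\<Prod>c\<in>J. 2 ^ e (\<iota> c))" using prod.reindex_bij_betw[OF \<iota>_bij, of "\<lambda>j. 2 ^ e j :: real"] by simp
    have X0: "0 < ?X" by (intro prod_pos) auto
    have one: "?X * (\<Sum>t\<in>?T. ?V k t) \<le> pivot_bound 6 E m d \<eta>" for k
      unfolding X sum_tuples_reindex
    proof (rule slab_vol_sum_le)
      fix c assume "c \<in> J"
      then have "e (\<iota> c) \<le> E" using e bij_betwE[OF \<iota>_bij] by blast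
      then show "2 ^ e (\<iota> c) \<le> (2 ^ E :: real)" by (intro power_increasing) auto
    qed (use \<eta> finite_J cardJ finite_dyadic_box card_dyadic_box card_dyadic_box_window in auto)
    have "(\<Sum>k\<in>?L. \<Sum>t\<in>?T. ?V k t) \<le> (\<Sum>k\<in>?L. pivot_bound 6 E m d \<eta> / ?X)"
      using one X0 by (intro sum_mono) (simp add: pos_le_divide_eq mult.commute)
    also have "\<dots> = real (card ?L) * (pivot_bound 6 E m d \<eta> / ?X)" by simp
    also have "\<dots> \<le> 6 ^ d * ?X * (pivot_bound 6 E m d \<eta> / ?X)"
      using \<eta> X0 by (intro mult_right_mono card_lattice_box divide_nonneg_pos pivot_bound_nonneg) auto
    also have "\<dots> = 6 ^ d * pivot_bound 6 E m d \<eta>" using X0 by simp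
    finally show "(\<Sum>k\<in>?L. \<Sum>t\<in>?T. ?V k t) \<le> 6 ^ d * pivot_bound 6 E m d \<eta>" .
  qed simp
  finally show ?thesis by (simp add: mult.assoc)
qed

end

section \<open>Almost every quadratic form\<close>

text \<open>
  Powers of \<open>\<nu> = log \<lambda>\<close> are absorbed by \<open>\<lambda> ^ \<epsilon>\<close>.  The constant comes from \<open>x \<le> exp x\<close> with
  \<open>x = c * (\<nu> + 2)\<close>.
\<close>

lemma power_le_const_powr:
  fixes \<epsilon> :: real
  assumes \<epsilon>: "0 < \<epsilon>"
  shows "\<exists>C>0. \<forall>\<nu>::nat. (real \<nu> + 2) ^ p \<le> C * 2 powr (\<epsilon> * real \<nu>)"
proof (cases "p = 0")
  case True
  have "1 \<le> 2 powr (\<epsilon> * real \<nu>)" for \<nu> using \<epsilon> by (intro ge_one_powr_ge_zero) auto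
  then show ?thesis using True by (intro exI[of _ 1]) auto
next
  case False
  define c where "c = \<epsilon> * ln 2 / real p"
  have c: "0 < c" using \<epsilon> False by (simp add: c_def)
  define C where "C = (exp (2 * c) / c) ^ p"
  have "(real \<nu> + 2) ^ p \<le> C * 2 powr (\<epsilon> * real \<nu>)" for \<nu> :: nat
  proof -
    have "c * (real \<nu> + 2) \<le> exp (c * (real \<nu> + 2))" using exp_ge_add_one_self[of "c * (real \<nu> + 2)"] by linarith
    also have "\<dots> = exp (2 * c) * exp (c * real \<nu>)" by (simp add: exp_add[symmetric] algebra_simps)
    finally have "real \<nu> + 2 \<le> exp (2 * c) / c * exp (c * real \<nu>)" using c by (simp add: field_simps)
    then have "(real \<nu> + 2) ^ p \<le> (exp (2 * c) / c * exp (c * real \<nu>)) ^ p" by (rule power_mono) simp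
    also have "\<dots> = C * exp (real p * (c * real \<nu>))" by (simp only: power_mult_distrib C_def exp_of_nat_mult)
    also have "real p * (c * real \<nu>) = \<epsilon> * real \<nu> * ln 2" using False by (simp add: c_def)
    also have "exp \<dots> = 2 powr (\<epsilon> * real \<nu>)" by (simp add: powr_def)
    finally show ?thesis .
  qed
  moreover have "0 < C" using c by (simp add: C_def)
  ultimately show ?thesis by blast
qed

definition tuples_controlled :: "nat \<Rightarrow> ((nat \<Rightarrow> int) \<Rightarrow> real) \<Rightarrow> bool" where
  "tuples_controlled d q \<longleftrightarrow> (\<forall>\<epsilon>>0. \<forall>m A. \<exists>C>0. \<forall>\<nu> \<mu>. \<forall>e\<in>PiE {1..d} (\<lambda>_. {..Suc \<nu>}).
      \<mu> \<le> A * \<nu> \<longrightarrow> real (close_tuples d m q e (8 * 2 ^ \<nu> / 2 ^ \<mu>))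
        \<le> C * 2 powr (\<epsilon> * real \<nu>) * moment_sum m d (1 / 2 ^ \<mu>) (2 ^ \<nu>))"

context diagonal_family
begin

text \<open>
  A Borel-Cantelli argument: the sum \<open>F\<close> over all scales of the counts, divided by the claimed bounds,
  has finite integral.  The condition \<open>\<mu> \<le> A * \<nu>\<close> leaves only \<open>O(\<nu>)\<close> scales of \<open>\<delta>\<close> for each scale
  of \<open>\<lambda>\<close>, so there are polynomially many summands in \<open>\<nu>\<close>, and the factor \<open>2 powr (- \<epsilon> * \<nu>)\<close> wins.
\<close>

lemma AE_close_tuples_bound:
  assumes \<epsilon>: "0 < \<epsilon>"
  shows "AE w in Pi\<^sub>M K (\<lambda>_. lborel). w \<in> region \<longrightarrow> (\<exists>C>0. \<forall>\<nu> \<mu>. \<forall>e\<in>PiE {1..d} (\<lambda>_. {..Suc \<nu>}).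
      \<mu> \<le> A * \<nu> \<longrightarrow> real (close_tuples d m (Q w) e (8 * 2 ^ \<nu> / 2 ^ \<mu>))
        \<le> C * 2 powr (\<epsilon> * real \<nu>) * moment_sum m d (1 / 2 ^ \<mu>) (2 ^ \<nu>))"
proof -
  let ?M = "Pi\<^sub>M K (\<lambda>_. lborel :: real measure)"
  define ES where "ES \<nu> = PiE {1..d} (\<lambda>_. {..Suc \<nu>})" for \<nu>
  have finES: "finite (ES \<nu>)" for \<nu> unfolding ES_def by (intro finite_PiE) auto
  have cardES: "real (card (ES \<nu>)) = (real \<nu> + 2) ^ d" for \<nu>
    unfolding ES_def by (simp add: card_PiE add.commute)
  define W where "W \<nu> \<mu> = 2 powr (\<epsilon> * real \<nu>) * moment_sum m d (1 / 2 ^ \<mu>) (2 ^ \<nu>)" for \<nu> \<mu> :: nat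
  have mpos: "0 < moment_sum m d (1 / 2 ^ \<mu>) (2 ^ \<nu>)" for \<nu> \<mu> :: nat
    by (rule less_le_trans[OF _ moment_sum_ge]) auto
  have W: "0 < W \<nu> \<mu>" for \<nu> \<mu> unfolding W_def using mpos by simp
  define g where "g \<nu> \<mu> e w = ennreal (real (close_tuples d m (Q w) e (8 * 2 ^ \<nu> / 2 ^ \<mu>)) / W \<nu> \<mu>) * indicator region w"
    for \<nu> \<mu> :: nat and e w
  have gM [measurable]: "g \<nu> \<mu> e \<in> borel_measurable ?M" for \<nu> \<mu> e
    unfolding g_def by measurable
  \<comment> \<open>If \<open>F w\<close> is finite, it is the constant that bounds all the quotients \<open>g\<close>.\<close>
  define F where "F w = (\<Sum>\<nu>. \<Sum>\<mu>\<le>A * \<nu>. \<Sum>e\<in>ES \<nu>. g \<nu> \<mu> e w)" for w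
  obtain C1 where C1: "0 < C1" "\<And>E \<eta>. 0 \<le> \<eta> \<Longrightarrow>
      pivot_bound 6 E m d \<eta> \<le> C1 * real (Suc E) ^ m * moment_sum m d (\<eta> / 2 ^ E) (2 ^ E)"
    using pivot_bound_le[of 6 m d] by auto
  obtain C2 where C2: "0 < C2" "\<And>\<delta> \<delta>' \<Lambda> \<Lambda>'. 0 \<le> \<delta> \<Longrightarrow> \<delta> \<le> 4 * \<delta>' \<Longrightarrow> 0 < \<Lambda> \<Longrightarrow> \<Lambda> \<le> 4 * \<Lambda>' \<Longrightarrow>
      moment_sum m d \<delta> \<Lambda> \<le> C2 * moment_sum m d \<delta>' \<Lambda>'"
    by (rule moment_sum_mono_scale[where c = 4 and m = m and n = d]) auto
  define c where "c = 2 ^ card (K - J) * 6 ^ d * C1 * C2"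
  have c0: "0 < c" using C1 C2 by (simp add: c_def)
  have int_g: "(\<integral>\<^sup>+w. g \<nu> \<mu> e w \<partial>?M) \<le> ennreal (c * (real \<nu> + 2) ^ m * 2 powr (- \<epsilon> * real \<nu>))"
    if e: "e \<in> ES \<nu>" for \<nu> \<mu> e
  proof -
    let ?\<eta> = "8 * 2 ^ \<nu> / 2 ^ \<mu> :: real"
    let ?ms = "moment_sum m d (1 / 2 ^ \<mu>) (2 ^ \<nu>)"
    have "(\<integral>\<^sup>+w. g \<nu> \<mu> e w \<partial>?M)
        = (\<integral>\<^sup>+w. ennreal (1 / W \<nu> \<mu>) * (ennreal (real (close_tuples d m (Q w) e ?\<eta>)) * indicator region w) \<partial>?M)"
      unfolding g_def using W[of \<nu> \<mu>]
      by (intro nn_integral_cong) (simp add: ennreal_mult[symmetric] mult.assoc[symmetric])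
    also have "\<dots> = ennreal (1 / W \<nu> \<mu>) * (\<integral>\<^sup>+w. ennreal (real (close_tuples d m (Q w) e ?\<eta>)) * indicator region w \<partial>?M)"
      by (rule nn_integral_cmult) measurable
    also have "\<dots> \<le> ennreal (1 / W \<nu> \<mu>) * ennreal (2 ^ card (K - J) * 6 ^ d * pivot_bound 6 (Suc \<nu>) m d ?\<eta>)"
      by (intro mult_left_mono integral_close_tuples_le) (use e in \<open>auto simp: ES_def PiE_iff\<close>)
    also have "\<dots> = ennreal (1 / W \<nu> \<mu> * (2 ^ card (K - J) * 6 ^ d * pivot_bound 6 (Suc \<nu>) m d ?\<eta>))"
      using W[of \<nu> \<mu>] by (intro ennreal_mult[symmetric] mult_nonneg_nonneg pivot_bound_nonneg) auto
    also have "\<dots> \<le> ennreal (c * (real \<nu> + 2) ^ m * 2 powr (- \<epsilon> * real \<nu>))"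
    proof (rule ennreal_leI)
      have "pivot_bound 6 (Suc \<nu>) m d ?\<eta> \<le> C1 * real (Suc (Suc \<nu>)) ^ m * moment_sum m d (?\<eta> / 2 ^ Suc \<nu>) (2 ^ Suc \<nu>)"
        by (rule C1(2)) simp
      also have "\<dots> \<le> C1 * real (Suc (Suc \<nu>)) ^ m * (C2 * ?ms)"
        using C1(1) by (intro mult_left_mono C2(2)) auto
      also have "real (Suc (Suc \<nu>)) = real \<nu> + 2" by simp
      finally have pb: "pivot_bound 6 (Suc \<nu>) m d ?\<eta> \<le> C1 * (real \<nu> + 2) ^ m * (C2 * ?ms)" .
      have "1 / W \<nu> \<mu> * (2 ^ card (K - J) * 6 ^ d * pivot_bound 6 (Suc \<nu>) m d ?\<eta>)
          \<le> 1 / W \<nu> \<mu> * (2 ^ card (K - J) * 6 ^ d * (C1 * (real \<nu> + 2) ^ m * (C2 * ?ms)))"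
        using W[of \<nu> \<mu>] by (intro mult_left_mono pb) auto
      also have "\<dots> = c * (real \<nu> + 2) ^ m * (?ms / W \<nu> \<mu>)" by (simp add: c_def)
      also have "?ms / W \<nu> \<mu> = 2 powr (- \<epsilon> * real \<nu>)"
        unfolding W_def using mpos[of \<mu> \<nu>] by (simp add: powr_minus_divide)
      finally show "1 / W \<nu> \<mu> * (2 ^ card (K - J) * 6 ^ d * pivot_bound 6 (Suc \<nu>) m d ?\<eta>)
          \<le> c * (real \<nu> + 2) ^ m * 2 powr (- \<epsilon> * real \<nu>)" .
    qed
    finally show ?thesis .
  qed
  obtain P where P: "0 < P" "\<And>\<nu>::nat. (real \<nu> + 2) ^ (m + d + 1) \<le> P * 2 powr (\<epsilon> / 2 * real \<nu>)"
    using power_le_const_powr[of "\<epsilon> / 2" "m + d + 1"] \<epsilon> by auto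
  define q where "q = 2 powr (- \<epsilon> / 2)"
  have q: "0 < q" "q < 1" using \<epsilon> by (auto simp: q_def powr_less_one)
  define h where "h \<nu> = real (Suc A) * c * P * q ^ \<nu>" for \<nu> :: nat
  have h0: "0 \<le> h \<nu>" for \<nu> using c0 P q by (simp add: h_def)
  have level: "(\<integral>\<^sup>+w. (\<Sum>\<mu>\<le>A * \<nu>. \<Sum>e\<in>ES \<nu>. g \<nu> \<mu> e w) \<partial>?M) \<le> ennreal (h \<nu>)" for \<nu>
  proof -
    let ?x = "c * (real \<nu> + 2) ^ m * 2 powr (- \<epsilon> * real \<nu>)"
    have x0: "0 \<le> ?x" using c0 by simp
    have "(\<integral>\<^sup>+w. (\<Sum>\<mu>\<le>A * \<nu>. \<Sum>e\<in>ES \<nu>. g \<nu> \<mu> e w) \<partial>?M) = (\<Sum>\<mu>\<le>A * \<nu>. \<Sum>e\<in>ES \<nu>. \<integral>\<^sup>+w. g \<nu> \<mu> e w \<partial>?M)"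
      by (subst nn_integral_sum, measurable) (intro sum.cong refl nn_integral_sum gM)
    also have "\<dots> \<le> (\<Sum>\<mu>\<le>A * \<nu>. \<Sum>e\<in>ES \<nu>. ennreal ?x)"
      by (intro sum_mono int_g)
    also have "\<dots> = of_nat (Suc (A * \<nu>) * card (ES \<nu>)) * ennreal ?x" by (simp only: sum_constant card_atMost of_nat_mult mult.assoc)
    also have "\<dots> = ennreal (real (Suc (A * \<nu>) * card (ES \<nu>)) * ?x)"
      using x0 by (simp only: ennreal_of_nat_eq_real_of_nat ennreal_mult of_nat_0_le_iff)
    also have "\<dots> \<le> ennreal (h \<nu>)"
    proof (rule ennreal_leI)
      have "real (Suc (A * \<nu>)) \<le> real (Suc A) * (real \<nu> + 2)" by (simp add: algebra_simps)
      then have "real (Suc (A * \<nu>) * card (ES \<nu>)) * ?x \<le> (real (Suc A) * (real \<nu> + 2) * (real \<nu> + 2) ^ d) * ?x"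
        unfolding of_nat_mult cardES using x0 by (intro mult_right_mono) auto
      also have "\<dots> = real (Suc A) * c * (real \<nu> + 2) ^ (m + d + 1) * 2 powr (- \<epsilon> * real \<nu>)"
        by (simp add: power_add)
      also have "\<dots> \<le> real (Suc A) * c * (P * 2 powr (\<epsilon> / 2 * real \<nu>)) * 2 powr (- \<epsilon> * real \<nu>)"
        using c0 by (intro mult_left_mono mult_right_mono P) auto
      also have "\<dots> = real (Suc A) * c * P * (2 powr (\<epsilon> / 2 * real \<nu>) * 2 powr (- \<epsilon> * real \<nu>))" by simp
      also have "2 powr (\<epsilon> / 2 * real \<nu>) * 2 powr (- \<epsilon> * real \<nu>) = 2 powr (- \<epsilon> / 2 * real \<nu>)"
        by (simp add: powr_add[symmetric])
      also have "\<dots> = q ^ \<nu>" by (simp add: q_def powr_power mult.commute)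
      finally show "real (Suc (A * \<nu>) * card (ES \<nu>)) * ?x \<le> h \<nu>" by (simp add: h_def)
    qed
    finally show ?thesis .
  qed
  have FM: "F \<in> borel_measurable ?M" unfolding F_def by measurable
  have "(\<integral>\<^sup>+w. F w \<partial>?M) = (\<Sum>\<nu>. \<integral>\<^sup>+w. (\<Sum>\<mu>\<le>A * \<nu>. \<Sum>e\<in>ES \<nu>. g \<nu> \<mu> e w) \<partial>?M)"
    unfolding F_def by (rule nn_integral_suminf) measurable
  also have "\<dots> \<le> (\<Sum>\<nu>. ennreal (h \<nu>))" by (intro suminf_le level summableI)
  also have "\<dots> < top"
  proof -
    have "summable h" unfolding h_def using q by (intro summable_mult summable_geometric) auto
    then show ?thesis using ennreal_suminf_neq_top[OF _ h0] by (simp add: less_top)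
  qed
  finally have "AE w in ?M. F w \<noteq> \<infinity>"
    by (intro nn_integral_noteq_infinite FM) auto
  then show ?thesis
  proof (rule AE_mp, intro AE_I2 impI)
    fix w assume Fw: "F w \<noteq> \<infinity>" and w: "w \<in> region"
    define C where "C = enn2real (F w) + 1"
    have "real (close_tuples d m (Q w) e (8 * 2 ^ \<nu> / 2 ^ \<mu>)) \<le> C * 2 powr (\<epsilon> * real \<nu>) * moment_sum m d (1 / 2 ^ \<mu>) (2 ^ \<nu>)"
      if e: "e \<in> PiE {1..d} (\<lambda>_. {..Suc \<nu>})" and \<mu>: "\<mu> \<le> A * \<nu>" for \<nu> \<mu> e
    proof -
      let ?T = "real (close_tuples d m (Q w) e (8 * 2 ^ \<nu> / 2 ^ \<mu>))"
      have "ennreal (?T / W \<nu> \<mu>) = g \<nu> \<mu> e w" using w by (simp add: g_def)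
      also have "\<dots> \<le> (\<Sum>e\<in>ES \<nu>. g \<nu> \<mu> e w)" using e finES by (intro member_le_sum) (auto simp: ES_def)
      also have "\<dots> \<le> (\<Sum>\<mu>\<le>A * \<nu>. \<Sum>e\<in>ES \<nu>. g \<nu> \<mu> e w)" using \<mu> by (intro member_le_sum) auto
      also have "\<dots> \<le> F w"
        unfolding F_def using sum_le_suminf[of "\<lambda>\<nu>. \<Sum>\<mu>\<le>A * \<nu>. \<Sum>e\<in>ES \<nu>. g \<nu> \<mu> e w" "{\<nu>}"] by simp
      also have "F w = ennreal (enn2real (F w))" using Fw by (simp add: less_top)
      finally have "?T / W \<nu> \<mu> \<le> enn2real (F w)" by simp
      then have "?T / W \<nu> \<mu> \<le> C" by (simp add: C_def)
      then show ?thesis using W[of \<nu> \<mu>] by (simp add: pos_divide_le_eq W_def mult.assoc)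
    qed
    moreover have "0 < C" by (simp add: C_def add_nonneg_pos)
    ultimately show "\<exists>C>0. \<forall>\<nu> \<mu>. \<forall>e\<in>PiE {1..d} (\<lambda>_. {..Suc \<nu>}).
      \<mu> \<le> A * \<nu> \<longrightarrow> real (close_tuples d m (Q w) e (8 * 2 ^ \<nu> / 2 ^ \<mu>))
        \<le> C * 2 powr (\<epsilon> * real \<nu>) * moment_sum m d (1 / 2 ^ \<mu>) (2 ^ \<nu>)" by blast
  qed
qed

text \<open>
  The property for \<open>\<epsilon>\<close> follows from that for any smaller exponent, so the values \<open>1 / (n + 1)\<close>
  suffice and only countably many null sets are involved.
\<close>

lemma AE_tuples_controlled: "AE w in Pi\<^sub>M K (\<lambda>_. lborel). w \<in> region \<longrightarrow> tuples_controlled d (Q w)"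
proof -
  let ?P = "\<lambda>w \<epsilon> m A. \<exists>C>0. \<forall>\<nu> \<mu>. \<forall>e\<in>PiE {1..d} (\<lambda>_. {..Suc \<nu>}).
      \<mu> \<le> A * \<nu> \<longrightarrow> real (close_tuples d m (Q w) e (8 * 2 ^ \<nu> / 2 ^ \<mu>))
        \<le> C * 2 powr (\<epsilon> * real \<nu>) * moment_sum m d (1 / 2 ^ \<mu>) (2 ^ \<nu>)"
  have "AE w in Pi\<^sub>M K (\<lambda>_. lborel). \<forall>n m A. w \<in> region \<longrightarrow> ?P w (inverse (real (Suc n))) m A"
    unfolding AE_all_countable by (intro allI AE_close_tuples_bound) simp
  then show ?thesis
  proof (rule AE_mp, intro AE_I2 impI)
    fix w assume *: "\<forall>n m A. w \<in> region \<longrightarrow> ?P w (inverse (real (Suc n))) m A" and w: "w \<in> region"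
    show "tuples_controlled d (Q w)"
      unfolding tuples_controlled_def
    proof (intro allI impI)
      fix \<epsilon> :: real and m A assume "0 < \<epsilon>"
      then obtain n where n: "inverse (real (Suc n)) < \<epsilon>" using reals_Archimedean by blast
      have "?P w (inverse (real (Suc n))) m A" by (rule mp[OF spec[OF spec[OF spec[OF *]]] w])
      then obtain C where C: "0 < C" "\<forall>\<nu> \<mu>. \<forall>e\<in>PiE {1..d} (\<lambda>_. {..Suc \<nu>}). \<mu> \<le> A * \<nu> \<longrightarrow>
          real (close_tuples d m (Q w) e (8 * 2 ^ \<nu> / 2 ^ \<mu>))
            \<le> C * 2 powr (inverse (real (Suc n)) * real \<nu>) * moment_sum m d (1 / 2 ^ \<mu>) (2 ^ \<nu>)"
        by (elim exE conjE)
      show "?P w \<epsilon> m A"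
      proof (intro exI[of _ C] conjI allI ballI impI C(1))
        fix \<nu> \<mu> e assume "e \<in> PiE {1..d} (\<lambda>_. {..Suc \<nu>})" "\<mu> \<le> A * \<nu>"
        then have "real (close_tuples d m (Q w) e (8 * 2 ^ \<nu> / 2 ^ \<mu>))
            \<le> C * 2 powr (inverse (real (Suc n)) * real \<nu>) * moment_sum m d (1 / 2 ^ \<mu>) (2 ^ \<nu>)"
          by (rule C(2)[THEN spec, THEN spec, THEN bspec, THEN mp])
        also have "\<dots> \<le> C * 2 powr (\<epsilon> * real \<nu>) * moment_sum m d (1 / 2 ^ \<mu>) (2 ^ \<nu>)"
          using C(1) n by (intro mult_right_mono mult_left_mono powr_mono moment_sum_nonneg) auto
        finally show "real (close_tuples d m (Q w) e (8 * 2 ^ \<nu> / 2 ^ \<mu>))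
            \<le> C * 2 powr (\<epsilon> * real \<nu>) * moment_sum m d (1 / 2 ^ \<mu>) (2 ^ \<nu>)" .
      qed
    qed
  qed
qed

end

section \<open>Lattice points in a thin ellipsoidal shell\<close>

definition shell_points :: "nat \<Rightarrow> (nat \<Rightarrow> nat \<Rightarrow> real) \<Rightarrow> real \<Rightarrow> real \<Rightarrow> (nat \<Rightarrow> int) set" where
  "shell_points d \<beta> \<Lambda> \<delta> =
     {k \<in> lattice d. \<bar>sqrt (quad_form d \<beta> (\<lambda>i. real_of_int (k i))) - \<Lambda>\<bar> \<le> \<delta>}"

text \<open>
  With the constant \<open>4 / 9\<close>, a point in a shell of radius \<open>\<Lambda> > 1\<close> and width less than 1 has coordinates
  of size at most \<open>3 / 2 * (2 * \<Lambda>) = 3 * \<Lambda>\<close>.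
\<close>

definition coercive_form :: "nat \<Rightarrow> (nat \<Rightarrow> nat \<Rightarrow> real) \<Rightarrow> bool" where
  "coercive_form d \<beta> \<longleftrightarrow> (\<forall>x. \<forall>j\<in>{1..d}. 4 / 9 * (x j)\<^sup>2 \<le> quad_form d \<beta> x)"

lemma coercive_formD: "coercive_form d \<beta> \<Longrightarrow> j \<in> {1..d} \<Longrightarrow> 4 / 9 * (x j)\<^sup>2 \<le> quad_form d \<beta> x"
  by (auto simp: coercive_form_def)

lemma shell_points_coord:
  assumes "coercive_form d \<beta>" "k \<in> shell_points d \<beta> \<Lambda> \<delta>" "0 < \<delta>" "\<delta> < 1" "1 < \<Lambda>" "j \<in> {1..d}"
  shows "\<bar>real_of_int (k j)\<bar> \<le> 3 * \<Lambda>"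
proof -
  let ?q = "quad_form d \<beta> (\<lambda>i. real_of_int (k i))"
  have c: "4 / 9 * (real_of_int (k j))\<^sup>2 \<le> ?q" using coercive_formD[OF assms(1,6), of "\<lambda>i. real_of_int (k i)"] .
  then have q0: "0 \<le> ?q" by (rule order_trans[rotated]) simp
  have "sqrt ?q \<le> 2 * \<Lambda>" using assms by (auto simp: shell_points_def)
  then have "(sqrt ?q)\<^sup>2 \<le> (2 * \<Lambda>)\<^sup>2" using q0 by (intro power_mono) auto
  then have "(real_of_int (k j))\<^sup>2 \<le> (3 * \<Lambda>)\<^sup>2" using c q0 by (simp add: power_mult_distrib)
  then show ?thesis using assms(5) by (intro power2_le_imp_le[of "\<bar>real_of_int (k j)\<bar>"]) auto
qed

lemma finite_shell_points:
  assumes "coercive_form d \<beta>" "0 < \<delta>" "\<delta> < 1" "1 < \<Lambda>"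
  shows "finite (shell_points d \<beta> \<Lambda> \<delta>)"
proof (rule finite_subset)
  show "shell_points d \<beta> \<Lambda> \<delta> \<subseteq> PiE {1..d} (\<lambda>_. {- \<lceil>3 * \<Lambda>\<rceil>..\<lceil>3 * \<Lambda>\<rceil>})"
  proof
    fix k assume k: "k \<in> shell_points d \<beta> \<Lambda> \<delta>"
    have "k j \<in> {- \<lceil>3 * \<Lambda>\<rceil>..\<lceil>3 * \<Lambda>\<rceil>}" if "j \<in> {1..d}" for j
      using shell_points_coord[OF assms(1) k assms(2-4) that] by auto linarith+
    then show "k \<in> PiE {1..d} (\<lambda>_. {- \<lceil>3 * \<Lambda>\<rceil>..\<lceil>3 * \<Lambda>\<rceil>})"
      using k by (auto simp: shell_points_def lattice_def PiE_iff)
  qed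
  show "finite (PiE {1..d} (\<lambda>_. {- \<lceil>3 * \<Lambda>\<rceil>..\<lceil>3 * \<Lambda>\<rceil>}))" by (intro finite_PiE) auto
qed

lemma shell_points_close:
  assumes "coercive_form d \<beta>" "k \<in> shell_points d \<beta> \<Lambda> \<delta>" "l \<in> shell_points d \<beta> \<Lambda> \<delta>" "0 < \<delta>" "\<delta> < 1" "1 < \<Lambda>" "1 \<le> d"
  shows "\<bar>quad_form d \<beta> (\<lambda>i. real_of_int (k i)) - quad_form d \<beta> (\<lambda>i. real_of_int (l i))\<bar> \<le> 8 * \<Lambda> * \<delta>"
proof -
  let ?q = "\<lambda>k. quad_form d \<beta> (\<lambda>i. real_of_int (k i))"
  have q0: "0 \<le> ?q k" for k
  proof -
    have "4 / 9 * (real_of_int (k 1))\<^sup>2 \<le> ?q k" using coercive_formD[OF assms(1), of 1 "\<lambda>i. real_of_int (k i)"] assms(7) by simp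
    then show ?thesis by (rule order_trans[rotated]) simp
  qed
  have s: "\<bar>sqrt (?q k) - \<Lambda>\<bar> \<le> \<delta>" "\<bar>sqrt (?q l) - \<Lambda>\<bar> \<le> \<delta>" using assms by (auto simp: shell_points_def)
  have "?q k - ?q l = (sqrt (?q k) - sqrt (?q l)) * (sqrt (?q k) + sqrt (?q l))"
    using q0 by (simp add: algebra_simps)
  also have "\<bar>\<dots>\<bar> = \<bar>sqrt (?q k) - sqrt (?q l)\<bar> * \<bar>sqrt (?q k) + sqrt (?q l)\<bar>" by (rule abs_mult)
  also have "\<dots> \<le> (2 * \<delta>) * (4 * \<Lambda>)"
    using s assms q0[of k] q0[of l] by (intro mult_mono) auto
  finally show ?thesis by (simp add: mult_ac)
qed

text \<open>
  All \<open>m + 1\<close> entries of a tuple can be chosen freely in \<open>S\<close>.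
\<close>

lemma card_power_le_close_tuples:
  assumes "S \<subseteq> lattice_box d e" "\<And>k l. k \<in> S \<Longrightarrow> l \<in> S \<Longrightarrow> \<bar>q k - q l\<bar> \<le> \<eta>"
  shows "card S ^ Suc m \<le> close_tuples d m q e \<eta>"
proof -
  let ?T = "\<lambda>k. {t \<in> PiE {..<m} (\<lambda>_. lattice_box d e). \<forall>i<m. \<bar>q (t i) - q k\<bar> \<le> \<eta>}"
  have finT: "finite (PiE {..<m} (\<lambda>_. lattice_box d e))" by (intro finite_PiE finite_lattice_box) auto
  have "card S ^ m \<le> card (?T k)" if "k \<in> S" for k
  proof -
    have "card S ^ m = card (PiE {..<m} (\<lambda>_. S))" by (simp add: card_PiE)
    also have "\<dots> \<le> card (?T k)"
    proof (rule card_mono)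
      show "finite (?T k)" using finT by simp
      show "PiE {..<m} (\<lambda>_. S) \<subseteq> ?T k"
      proof
        fix t assume t: "t \<in> PiE {..<m} (\<lambda>_. S)"
        then have "t i \<in> S" if "i < m" for i using that by auto
        then show "t \<in> ?T k" using t assms that by (auto simp: PiE_iff)
      qed
    qed
    finally show ?thesis .
  qed
  then have "card S * card S ^ m \<le> (\<Sum>k\<in>S. card (?T k))" using sum_mono[of S "\<lambda>_. card S ^ m" "\<lambda>k. card (?T k)"] by simp
  also have "\<dots> \<le> close_tuples d m q e \<eta>"
    unfolding close_tuples_def by (intro sum_mono2 finite_lattice_box assms) auto
  finally show ?thesis by simp
qed

lemma le_powr_inverse:
  fixes x y :: real
  assumes "0 \<le> x" "x ^ b \<le> y" "1 \<le> b"
  shows "x \<le> y powr (1 / real b)"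
proof (cases "x = 0")
  case False
  then have "x = (x ^ b) powr (1 / real b)" using assms by (simp add: powr_realpow[symmetric] powr_powr)
  also have "\<dots> \<le> y powr (1 / real b)" using assms by (intro powr_mono2) auto
  finally show ?thesis .
qed simp

lemma shell_points_subset_boxes:
  assumes "coercive_form d \<beta>" "0 < \<delta>" "\<delta> < 1" "1 < \<Lambda>" "\<Lambda> < 2 ^ \<nu>"
  shows "shell_points d \<beta> \<Lambda> \<delta> \<subseteq> (\<Union>e\<in>PiE {1..d} (\<lambda>_. {..Suc \<nu>}). shell_points d \<beta> \<Lambda> \<delta> \<inter> lattice_box d e)"
proof
  fix k assume k: "k \<in> shell_points d \<beta> \<Lambda> \<delta>"
  have "\<exists>e. e \<le> Suc \<nu> \<and> k j \<in> dyadic_box e" if "j \<in> {1..d}" for j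
  proof -
    have "real_of_int \<bar>k j\<bar> + 1 < 2 ^ Suc (Suc \<nu>)"
      using shell_points_coord[OF assms(1) k assms(2-4) that] assms(4,5) by simp
    then obtain e where "e < Suc (Suc \<nu>)" "k j \<in> dyadic_box e" by (rule dyadic_box_cover)
    then show ?thesis by (intro exI[of _ e]) auto
  qed
  then obtain e where e: "\<And>j. j \<in> {1..d} \<Longrightarrow> e j \<le> Suc \<nu> \<and> k j \<in> dyadic_box (e j)" by metis
  have "restrict e {1..d} \<in> PiE {1..d} (\<lambda>_. {..Suc \<nu>})" using e by auto
  moreover have "k \<in> lattice_box d (restrict e {1..d})"
    using e k by (auto simp: lattice_box_def shell_points_def lattice_def PiE_iff)
  ultimately show "k \<in> (\<Union>e\<in>PiE {1..d} (\<lambda>_. {..Suc \<nu>}). shell_points d \<beta> \<Lambda> \<delta> \<inter> lattice_box d e)"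
    using k by blast
qed

text \<open>
  The radius and the width are compared with powers of 2, \<open>\<Lambda> \<le> 2 ^ \<nu> \<le> 2 * \<Lambda>\<close> and
  \<open>\<delta> \<le> 1 / 2 ^ \<mu> \<le> 2 * \<delta>\<close>, and the part of the shell in each dyadic box is bounded by the \<open>b\<close>-th root
  of a tuple count.  The hypothesis \<open>1 \<le> \<Lambda> ^ A * \<delta>\<close> gives \<open>\<mu> \<le> A * \<nu>\<close> for these scales.
\<close>

lemma shell_card_bound:
  assumes d: "1 \<le> d" and co: "coercive_form d \<beta>"
    and tc: "tuples_controlled d (\<lambda>k. quad_form d \<beta> (\<lambda>i. real_of_int (k i)))"
    and \<epsilon>: "0 < \<epsilon>" and b: "1 \<le> b"
  shows "\<exists>C>0. \<forall>\<Lambda> \<delta>. 0 < \<delta> \<and> \<delta> < 1 \<and> 1 < \<Lambda> \<and> 1 \<le> \<Lambda> ^ A * \<delta> \<longrightarrow>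
     real (card (shell_points d \<beta> \<Lambda> \<delta>)) \<le> C * \<Lambda> powr \<epsilon> * moment_sum (b - 1) d \<delta> \<Lambda> powr (1 / real b)"
proof -
  let ?q = "\<lambda>k. quad_form d \<beta> (\<lambda>i. real_of_int (k i))"
  let ?m = "b - 1"
  obtain C where C: "0 < C" "\<And>\<nu> \<mu> e. e \<in> PiE {1..d} (\<lambda>_. {..Suc \<nu>}) \<Longrightarrow> \<mu> \<le> A * \<nu> \<Longrightarrow>
      real (close_tuples d ?m ?q e (8 * 2 ^ \<nu> / 2 ^ \<mu>)) \<le> C * 2 powr (\<epsilon> / 2 * real \<nu>) * moment_sum ?m d (1 / 2 ^ \<mu>) (2 ^ \<nu>)"
    using tc \<epsilon> unfolding tuples_controlled_def by (metis half_gt_zero)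
  obtain P where P: "0 < P" "\<And>\<nu>::nat. (real \<nu> + 2) ^ d \<le> P * 2 powr (\<epsilon> / 2 * real \<nu>)"
    using power_le_const_powr[of "\<epsilon> / 2" d] \<epsilon> by auto
  obtain C2 where C2: "0 < C2" "\<And>\<delta> \<delta>' \<Lambda> \<Lambda>'. 0 \<le> \<delta> \<Longrightarrow> \<delta> \<le> 2 * \<delta>' \<Longrightarrow> 0 < \<Lambda> \<Longrightarrow> \<Lambda> \<le> 2 * \<Lambda>' \<Longrightarrow>
      moment_sum ?m d \<delta> \<Lambda> \<le> C2 * moment_sum ?m d \<delta>' \<Lambda>'"
    by (rule moment_sum_mono_scale[where c = 2 and m = ?m and n = d]) auto
  define D where "D = P * (C * C2) powr (1 / real b) * 2 powr \<epsilon>"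
  have D0: "0 < D" using P C C2 by (simp add: D_def)
  have "real (card (shell_points d \<beta> \<Lambda> \<delta>)) \<le> D * \<Lambda> powr \<epsilon> * moment_sum ?m d \<delta> \<Lambda> powr (1 / real b)"
    if h: "0 < \<delta>" "\<delta> < 1" "1 < \<Lambda>" "1 \<le> \<Lambda> ^ A * \<delta>" for \<Lambda> \<delta>
  proof -
    let ?S = "shell_points d \<beta> \<Lambda> \<delta>"
    let ?ES = "\<lambda>\<nu>. PiE {1..d} (\<lambda>_. {..Suc \<nu>})"
    obtain N where N: "\<Lambda> < 2 ^ N" using real_arch_pow[of 2 \<Lambda>] by auto
    obtain n where n: "2 ^ n \<le> \<Lambda>" "\<Lambda> < 2 ^ Suc n" using dyadic_scale[OF _ N] h by auto
    define \<nu> where "\<nu> = Suc n"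
    have \<nu>: "2 ^ \<nu> \<le> 2 * \<Lambda>" "\<Lambda> < 2 ^ \<nu>" using n by (auto simp: \<nu>_def)
    obtain M where M: "1 / \<delta> < 2 ^ M" using real_arch_pow[of 2 "1 / \<delta>"] by auto
    have "1 \<le> 1 / \<delta>" using h by simp
    then obtain \<mu> where \<mu>: "2 ^ \<mu> \<le> 1 / \<delta>" "1 / \<delta> < 2 ^ Suc \<mu>" using dyadic_scale[OF _ M] by auto
    have \<delta>\<mu>: "\<delta> \<le> 1 / 2 ^ \<mu>" "1 / 2 ^ \<mu> \<le> 2 * \<delta>" using \<mu> h by (auto simp: field_simps)
    have \<mu>A: "\<mu> \<le> A * \<nu>"
    proof -
      have "2 ^ \<mu> \<le> 1 / \<delta>" by (rule \<mu>)
      also have "\<dots> \<le> \<Lambda> ^ A" using h by (simp add: pos_divide_le_eq)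
      also have "\<dots> \<le> (2 ^ \<nu>) ^ A" using \<nu> h by (intro power_mono) auto
      also have "\<dots> = 2 ^ (A * \<nu>)" by (simp add: power_mult[symmetric] mult.commute)
      finally show ?thesis by simp
    qed
    define Y where "Y = C * 2 powr (\<epsilon> / 2 * real \<nu>) * moment_sum ?m d (1 / 2 ^ \<mu>) (2 ^ \<nu>)"
    have box: "real (card (?S \<inter> lattice_box d e)) \<le> Y powr (1 / real b)" if e: "e \<in> ?ES \<nu>" for e
    proof (rule le_powr_inverse)
      \<comment> \<open>All points of the shell are close to each other at the tolerance of the dyadic scale.\<close>
      have "8 * \<Lambda> * \<delta> \<le> 8 * 2 ^ \<nu> * (1 / 2 ^ \<mu>)" using \<nu> h \<delta>\<mu> by (intro mult_mono) auto
      then have "card (?S \<inter> lattice_box d e) ^ Suc ?m \<le> close_tuples d ?m ?q e (8 * 2 ^ \<nu> / 2 ^ \<mu>)"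
        using shell_points_close[OF co _ _ h(1-3) d] by (intro card_power_le_close_tuples) force+
      then have "real (card (?S \<inter> lattice_box d e) ^ b) \<le> real (close_tuples d ?m ?q e (8 * 2 ^ \<nu> / 2 ^ \<mu>))"
        using b by simp
      also have "\<dots> \<le> Y" unfolding Y_def by (rule C(2)[OF e \<mu>A])
      finally show "real (card (?S \<inter> lattice_box d e)) ^ b \<le> Y" by simp
    qed (use b in auto)
    have finES: "finite (?ES \<nu>)" by (intro finite_PiE) auto
    have "card ?S \<le> card (\<Union>e\<in>?ES \<nu>. ?S \<inter> lattice_box d e)"
      using shell_points_subset_boxes[OF co h(1-3) \<nu>(2)] finES by (intro card_mono) (auto intro: finite_lattice_box)
    also have "\<dots> \<le> (\<Sum>e\<in>?ES \<nu>. card (?S \<inter> lattice_box d e))" by (rule card_UN_le[OF finES])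
    finally have "real (card ?S) \<le> (\<Sum>e\<in>?ES \<nu>. real (card (?S \<inter> lattice_box d e)))" by (simp flip: of_nat_sum)
    also have "\<dots> \<le> (\<Sum>e\<in>?ES \<nu>. Y powr (1 / real b))" by (intro sum_mono box)
    also have "\<dots> = (real \<nu> + 2) ^ d * Y powr (1 / real b)" by (simp add: card_PiE add.commute)
    also have "\<dots> \<le> (P * 2 powr (\<epsilon> / 2 * real \<nu>)) * Y powr (1 / real b)" by (intro mult_right_mono P) auto
    also have "Y powr (1 / real b) \<le> (C * 2 powr (\<epsilon> / 2 * real \<nu>) * (C2 * moment_sum ?m d \<delta> \<Lambda>)) powr (1 / real b)"
      unfolding Y_def using \<delta>\<mu> \<nu> h C(1)
      by (intro powr_mono2 mult_left_mono C2(2) mult_nonneg_nonneg moment_sum_nonneg) auto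
    also have "\<dots> = (C * C2) powr (1 / real b) * (2 powr (\<epsilon> / 2 * real \<nu>)) powr (1 / real b) * moment_sum ?m d \<delta> \<Lambda> powr (1 / real b)"
      using C(1) C2(1) moment_sum_nonneg[of \<delta> ?m d \<Lambda>] h by (simp add: powr_mult)
    also have "(2 powr (\<epsilon> / 2 * real \<nu>)) powr (1 / real b) \<le> 2 powr (\<epsilon> / 2 * real \<nu>)"
    proof -
      have "\<epsilon> / 2 * real \<nu> * (1 / real b) \<le> \<epsilon> / 2 * real \<nu> * 1"
        using b \<epsilon> by (intro mult_left_mono) auto
      then show ?thesis by (simp add: powr_powr)
    qed
    finally have "real (card ?S) \<le> (P * 2 powr (\<epsilon> / 2 * real \<nu>)) *
        ((C * C2) powr (1 / real b) * 2 powr (\<epsilon> / 2 * real \<nu>) * moment_sum ?m d \<delta> \<Lambda> powr (1 / real b))"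
      using P(1) by (simp add: mult_left_mono mult_right_mono)
    also have "\<dots> = P * (C * C2) powr (1 / real b) * (2 powr (\<epsilon> / 2 * real \<nu>) * 2 powr (\<epsilon> / 2 * real \<nu>)) * moment_sum ?m d \<delta> \<Lambda> powr (1 / real b)"
      by simp
    also have "2 powr (\<epsilon> / 2 * real \<nu>) * 2 powr (\<epsilon> / 2 * real \<nu>) = (2 ^ \<nu>) powr \<epsilon>"
      by (simp add: powr_add[symmetric] powr_realpow[symmetric] powr_powr mult.commute)
    also have "\<dots> \<le> (2 * \<Lambda>) powr \<epsilon>" using \<nu> \<epsilon> by (intro powr_mono2) auto
    also have "\<dots> = 2 powr \<epsilon> * \<Lambda> powr \<epsilon>" using h by (simp add: powr_mult)
    finally show ?thesis using P(1) by (simp add: D_def mult_ac mult_left_mono mult_right_mono)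
  qed
  then show ?thesis using D0 by blast
qed

lemma shell_points_mono: "\<delta> \<le> \<delta>' \<Longrightarrow> shell_points d \<beta> \<Lambda> \<delta> \<subseteq> shell_points d \<beta> \<Lambda> \<delta>'"
  by (auto simp: shell_points_def)

text \<open>
  The constant does not depend on \<open>b\<close>, although it does in \<open>shell_card_bound\<close>.  For very thin shells the
  moment \<open>b0\<close> is better than any other one up to \<open>\<Lambda> powr \<epsilon>\<close>; for all other shells and large \<open>b\<close> the
  first moment is good enough.  This leaves the finitely many values \<open>b \<le> B0 + d\<close>.
\<close>

lemma shell_card_uniform:
  assumes d: "1 \<le> d" and co: "coercive_form d \<beta>"
    and tc: "tuples_controlled d (\<lambda>k. quad_form d \<beta> (\<lambda>i. real_of_int (k i)))"
    and \<epsilon>: "0 < \<epsilon>"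
  shows "\<exists>C>0. \<forall>b\<ge>1. \<forall>\<Lambda> \<delta>. 0 < \<delta> \<and> \<delta> < 1 \<and> 1 < \<Lambda> \<longrightarrow>
     real (card (shell_points d \<beta> \<Lambda> \<delta>)) \<le> C * \<Lambda> powr \<epsilon> * moment_sum (b - 1) d \<delta> \<Lambda> powr (1 / real b)"
proof -
  let ?N = "\<lambda>\<Lambda> \<delta>. real (card (shell_points d \<beta> \<Lambda> \<delta>))"
  obtain A0 :: nat where A0: "6 * real d ^ 2 / \<epsilon> \<le> real A0" using real_arch_simple by blast
  define A where "A = Suc A0"
  have A: "6 * real d ^ 2 / \<epsilon> \<le> real A" "1 \<le> A" using A0 by (auto simp: A_def)
  have "\<exists>C>0. \<forall>\<Lambda> \<delta>. 0 < \<delta> \<and> \<delta> < 1 \<and> 1 < \<Lambda> \<and> 1 \<le> \<Lambda> ^ A * \<delta> \<longrightarrow>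
     ?N \<Lambda> \<delta> \<le> C * \<Lambda> powr (\<epsilon> / 2) * moment_sum (b - 1) d \<delta> \<Lambda> powr (1 / real b)" if "1 \<le> b" for b
    using shell_card_bound[OF d co tc _ that, of "\<epsilon> / 2" A] \<epsilon> by simp
  then obtain C where C: "\<And>b. 1 \<le> b \<Longrightarrow> 0 < C b"
    "\<And>b \<Lambda> \<delta>. 1 \<le> b \<Longrightarrow> 0 < \<delta> \<Longrightarrow> \<delta> < 1 \<Longrightarrow> 1 < \<Lambda> \<Longrightarrow> 1 \<le> \<Lambda> ^ A * \<delta> \<Longrightarrow>
     ?N \<Lambda> \<delta> \<le> C b * \<Lambda> powr (\<epsilon> / 2) * moment_sum (b - 1) d \<delta> \<Lambda> powr (1 / real b)"
    by metis
  obtain B0 :: nat where B0: "2 * real d * (real A + 1) / \<epsilon> \<le> real B0" using real_arch_simple by blast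
  define b0 where "b0 = A + d + 1"
  define D where "D = C b0 * real (d + 1) + C 1 + (\<Sum>b=1..B0 + d. C b)"
  have Cs0: "0 \<le> (\<Sum>b=1..B0 + d. C b)" using C(1) by (intro sum_nonneg) (auto intro: less_imp_le)
  have Cb0: "0 < C b0 * real (d + 1)" using C(1)[of b0] by (simp add: b0_def)
  have D0: "0 < D" using Cs0 Cb0 C(1)[of 1] by (simp add: D_def)
  have ms1: "1 \<le> moment_sum m d \<delta> \<Lambda> powr (1 / real b)" if "0 < \<delta>" "1 < \<Lambda>" for m b \<delta> \<Lambda>
  proof (rule ge_one_powr_ge_zero)
    have "1 \<le> \<Lambda> powr real d" using that by (intro ge_one_powr_ge_zero) auto
    also have "\<dots> \<le> moment_sum m d \<delta> \<Lambda>" using that by (intro moment_sum_ge) auto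
    finally show "1 \<le> moment_sum m d \<delta> \<Lambda>" .
  qed simp
  have "?N \<Lambda> \<delta> \<le> D * \<Lambda> powr \<epsilon> * moment_sum (b - 1) d \<delta> \<Lambda> powr (1 / real b)"
    if b: "1 \<le> b" and h: "0 < \<delta>" "\<delta> < 1" "1 < \<Lambda>" for b \<Lambda> \<delta>
  proof -
    let ?Z = "moment_sum (b - 1) d \<delta> \<Lambda> powr (1 / real b)"
    have Z1: "1 \<le> ?Z" using ms1[OF h(1,3)] .
    have half: "\<Lambda> powr (\<epsilon> / 2) * \<Lambda> powr (\<epsilon> / 2) = \<Lambda> powr \<epsilon>" by (simp add: powr_add[symmetric])
    have half_le: "\<Lambda> powr (\<epsilon> / 2) \<le> \<Lambda> powr \<epsilon>" using h \<epsilon> by (intro powr_mono) auto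
    consider (thin) "\<Lambda> ^ A * \<delta> < 1" | (large) "1 \<le> \<Lambda> ^ A * \<delta>" "B0 + d < b" | (small) "1 \<le> \<Lambda> ^ A * \<delta>" "b \<le> B0 + d"
      by linarith
    then show ?thesis
    proof cases
      case thin
      \<comment> \<open>The shell lies in the one of width \<open>1 / \<Lambda> ^ A\<close>, and the moment \<open>b0\<close> bounds the latter by
        \<open>\<Lambda> powr \<epsilon>\<close>: all exponents in its moment sum are at most \<open>3 * d\<^sup>2\<close>, independently of \<open>A\<close>.\<close>
      define \<delta>0 where "\<delta>0 = 1 / \<Lambda> ^ A"
      have \<Lambda>A: "1 < \<Lambda> ^ A" using h A by (intro one_less_power) auto
      have \<delta>0: "0 < \<delta>0" "\<delta>0 < 1" "\<delta> \<le> \<delta>0" "\<Lambda> ^ A * \<delta>0 = 1"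
        using \<Lambda>A thin h by (auto simp: \<delta>0_def field_simps)
      have "?N \<Lambda> \<delta> \<le> ?N \<Lambda> \<delta>0"
        using \<delta>0 h by (intro of_nat_mono card_mono finite_shell_points shell_points_mono co) auto
      also have "\<dots> \<le> C b0 * \<Lambda> powr (\<epsilon> / 2) * moment_sum (b0 - 1) d \<delta>0 \<Lambda> powr (1 / real b0)"
        using \<delta>0 h by (intro C(2)) (auto simp: b0_def)
      also have "moment_sum (b0 - 1) d \<delta>0 \<Lambda> powr (1 / real b0) \<le> real (d + 1) * \<Lambda> powr (\<epsilon> / 2)"
      proof -
        have "moment_sum (b0 - 1) d \<delta>0 \<Lambda> \<le> (\<Sum>r\<le>d. \<Lambda> powr (3 * real d ^ 2))"
          unfolding moment_sum_def
        proof (rule sum_mono2[THEN order_trans, rotated 3, OF sum_mono])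
          fix r assume "r \<in> {..d}"
          then have r: "r \<le> d" by simp
          have "\<delta>0 ^ r = \<Lambda> powr (- (real A * real r))"
            using h by (simp add: \<delta>0_def powr_minus powr_realpow[symmetric] powr_powr power_one_over inverse_eq_divide)
          then have "\<delta>0 ^ r * \<Lambda> powr (real d + real r * real (b0 - 1 + d) - real r * (real r + 1))
             = \<Lambda> powr (- (real A * real r) + (real d + real r * real (b0 - 1 + d) - real r * (real r + 1)))"
            by (simp only: powr_add)
          also have "\<dots> \<le> \<Lambda> powr (3 * real d ^ 2)"
          proof (rule powr_mono)
            have "real r * real d \<le> real d * real d" using r by (intro mult_right_mono) auto
            moreover have "real d \<le> real d * real d" using d by simp
            moreover have "0 \<le> real r * real r + real r" by simp
            moreover have "- (real A * real r) + (real d + real r * real (b0 - 1 + d) - real r * (real r + 1))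
                = real d + 2 * (real r * real d) - (real r * real r + real r)"
              by (simp add: b0_def algebra_simps)
            ultimately show "- (real A * real r) + (real d + real r * real (b0 - 1 + d) - real r * (real r + 1)) \<le> 3 * real d ^ 2"
              unfolding power2_eq_square by linarith
          qed (use h in simp)
          finally show "\<delta>0 ^ r * \<Lambda> powr (real d + real r * real (b0 - 1 + d) - real r * (real r + 1)) \<le> \<Lambda> powr (3 * real d ^ 2)" .
        qed (use \<delta>0 in auto)
        also have "\<dots> = real (d + 1) * \<Lambda> powr (3 * real d ^ 2)" by simp
        finally have "moment_sum (b0 - 1) d \<delta>0 \<Lambda> powr (1 / real b0) \<le> (real (d + 1) * \<Lambda> powr (3 * real d ^ 2)) powr (1 / real b0)"
          using \<delta>0 by (intro powr_mono2 moment_sum_nonneg) auto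
        also have "\<dots> = real (d + 1) powr (1 / real b0) * \<Lambda> powr (3 * real d ^ 2 / real b0)"
          using h by (simp add: powr_mult powr_powr)
        also have "\<dots> \<le> real (d + 1) powr 1 * \<Lambda> powr (\<epsilon> / 2)"
        proof (intro mult_mono powr_mono)
          have "6 * real d ^ 2 \<le> \<epsilon> * real A" using A(1) \<epsilon> by (simp add: pos_divide_le_eq mult.commute)
          also have "\<dots> \<le> \<epsilon> * real b0" using \<epsilon> by (intro mult_left_mono) (auto simp: b0_def)
          finally show "3 * real d ^ 2 / real b0 \<le> \<epsilon> / 2" by (simp add: b0_def field_simps)
        qed (use h in \<open>auto simp: b0_def\<close>)
        finally show ?thesis by simp
      qed
      finally have "?N \<Lambda> \<delta> \<le> C b0 * \<Lambda> powr (\<epsilon> / 2) * (real (d + 1) * \<Lambda> powr (\<epsilon> / 2))"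
        using C(1)[of b0] by (simp add: b0_def mult_left_mono)
      also have "\<dots> = C b0 * real (d + 1) * \<Lambda> powr \<epsilon> * 1" by (simp add: half[symmetric])
      also have "\<dots> \<le> D * \<Lambda> powr \<epsilon> * ?Z"
        using Z1 D0 Cs0 C(1)[of 1] Cb0 by (intro mult_mono) (auto simp: D_def)
      finally show ?thesis .
    next
      case large
      \<comment> \<open>The first moment is the count by volume, \<open>\<Lambda> powr d\<close>.  The last term of the moment sum shows
        that the right-hand side has reached this size, up to \<open>\<Lambda> powr (\<epsilon> / 2)\<close>.\<close>
      have "?N \<Lambda> \<delta> \<le> C 1 * \<Lambda> powr (\<epsilon> / 2) * moment_sum (1 - 1) d \<delta> \<Lambda> powr (1 / real 1)"
        using large h by (intro C(2)) auto
      also have "moment_sum (1 - 1) d \<delta> \<Lambda> powr (1 / real 1) = \<Lambda> powr real d"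
        using h by (simp add: moment_sum_def)
      also have "\<Lambda> powr real d \<le> \<Lambda> powr (\<epsilon> / 2) * ?Z"
      proof -
        have mb: "min (b - 1) d = d" using large by simp
        have b0: "0 < real b" using b by simp
        have "\<Lambda> powr (- (real A * real d)) * \<Lambda> powr (real d * (real b - 1)) \<le> \<delta> ^ d * \<Lambda> powr (real d * (real b - 1))"
        proof (rule mult_right_mono)
          have "\<Lambda> powr (- (real A * real d)) = (1 / \<Lambda> ^ A) ^ d"
            using h by (simp add: powr_minus powr_realpow[symmetric] powr_powr power_one_over inverse_eq_divide)
          also have "\<dots> \<le> \<delta> ^ d" using large h by (intro power_mono) (auto simp: pos_divide_le_eq mult.commute)
          finally show "\<Lambda> powr (- (real A * real d)) \<le> \<delta> ^ d" .
        qed simp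
        also have "\<dots> = \<delta> ^ d * \<Lambda> powr (real d + real d * real (b - 1 + d) - real d * (real d + 1))"
          using b by (simp add: of_nat_diff algebra_simps)
        also have "\<dots> \<le> moment_sum (b - 1) d \<delta> \<Lambda>"
          unfolding moment_sum_def mb
          using member_le_sum[of d "{..d}" "\<lambda>r. \<delta> ^ r * \<Lambda> powr (real d + real r * real (b - 1 + d) - real r * (real r + 1))"] h
          by auto
        finally have "\<Lambda> powr (real d * (real b - 1) - real A * real d) \<le> moment_sum (b - 1) d \<delta> \<Lambda>"
          by (simp add: powr_add[symmetric])
        then have "(\<Lambda> powr (real d * (real b - 1) - real A * real d)) powr (1 / real b) \<le> ?Z"
          by (intro powr_mono2) auto
        then have Zge: "\<Lambda> powr ((real d * (real b - 1) - real A * real d) * (1 / real b)) \<le> ?Z"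
          by (simp only: powr_powr)
        have "real d \<le> \<epsilon> / 2 + (real d * (real b - 1) - real A * real d) * (1 / real b)"
        proof -
          have "2 * real d * (real A + 1) \<le> \<epsilon> * real B0" using B0 \<epsilon> by (simp add: pos_divide_le_eq mult.commute)
          also have "\<dots> \<le> \<epsilon> * real b" using large \<epsilon> by (intro mult_left_mono) auto
          finally show ?thesis using b0 by (simp add: field_simps)
        qed
        then have "\<Lambda> powr real d \<le> \<Lambda> powr (\<epsilon> / 2 + (real d * (real b - 1) - real A * real d) * (1 / real b))"
          using h by (intro powr_mono) auto
        also have "\<dots> \<le> \<Lambda> powr (\<epsilon> / 2) * ?Z"
          unfolding powr_add by (intro mult_left_mono Zge) auto
        finally show ?thesis .
      qed
      finally have "?N \<Lambda> \<delta> \<le> C 1 * \<Lambda> powr (\<epsilon> / 2) * (\<Lambda> powr (\<epsilon> / 2) * ?Z)"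
        using C(1)[of 1] by (simp add: mult_left_mono)
      also have "\<dots> = C 1 * \<Lambda> powr \<epsilon> * ?Z" by (simp add: half[symmetric])
      also have "\<dots> \<le> D * \<Lambda> powr \<epsilon> * ?Z"
        using Cs0 Cb0 by (intro mult_right_mono) (auto simp: D_def)
      finally show ?thesis .
    next
      case small
      have "?N \<Lambda> \<delta> \<le> C b * \<Lambda> powr (\<epsilon> / 2) * ?Z" using small h b by (intro C(2)) auto
      also have "C b \<le> (\<Sum>b=1..B0 + d. C b)"
        using small b C(1) by (intro member_le_sum) (auto intro: less_imp_le)
      also have "\<dots> \<le> D" using Cb0 C(1)[of 1] by (simp add: D_def)
      finally have "?N \<Lambda> \<delta> \<le> D * \<Lambda> powr (\<epsilon> / 2) * ?Z" by (simp add: mult_right_mono)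
      also have "\<dots> \<le> D * \<Lambda> powr \<epsilon> * ?Z"
        using half_le D0 by (intro mult_right_mono mult_left_mono) auto
      finally show ?thesis .
    qed
  qed
  then show ?thesis using D0 by blast
qed

section \<open>The operator norm of the spectral projector\<close>

lemma character_norm [simp]: "norm (character d k x) = 1"
  by (simp add: character_def)

lemma character_measurable [measurable]: "character d k \<in> borel_measurable (torus d)"
proof -
  have "(\<lambda>x. x i) \<in> borel_measurable (torus d)" if "i \<in> {1..d}" for i
  proof -
    have "(\<lambda>x. x i) \<in> torus d \<rightarrow>\<^sub>M restrict_space lborel {0..<1::real}"
      unfolding torus_def using that by (rule measurable_component_singleton)
    moreover have "(\<lambda>y. y) \<in> restrict_space lborel {0..<1::real} \<rightarrow>\<^sub>M borel"
      by (rule measurable_restrict_space1) simp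
    ultimately show ?thesis by (rule measurable_compose)
  qed
  then have "(\<lambda>x. 2 * pi * (\<Sum>i=1..d. real_of_int (k i) * x i)) \<in> borel_measurable (torus d)"
    by (intro borel_measurable_times borel_measurable_sum borel_measurable_const) auto
  moreover have "cis \<in> borel_measurable borel"
    by (intro borel_measurable_continuous_onI continuous_intros)
  ultimately show ?thesis unfolding character_def by (rule measurable_compose)
qed

lemma fourier_coeff_le:
  assumes "(LINT x|torus d. norm (f x)) \<le> 1"
  shows "norm (fourier_coeff d f k) \<le> 1"
proof -
  have "norm (fourier_coeff d f k) \<le> (LINT x|torus d. norm (f x * cnj (character d k x)))"
    unfolding fourier_coeff_def by (rule integral_norm_bound)
  also have "\<dots> = (LINT x|torus d. norm (f x))" by (simp add: norm_mult)
  finally show ?thesis using assms by simp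
qed

text \<open>
  The cutoff vanishes outside \<open>[-1, 1]\<close>, so only frequencies in the shell contribute, each with a
  coefficient of absolute value at most 1.
\<close>

lemma L1_Linf_norm_le_card:
  assumes chi: "is_cutoff chi" and \<delta>: "0 < \<delta>" and fin: "finite (shell_points d \<beta> \<Lambda> \<delta>)"
  shows "L1_Linf_norm (torus d) (spectral_proj chi d \<beta> \<Lambda> \<delta>) \<le> ennreal (real (card (shell_points d \<beta> \<Lambda> \<delta>)))"
  unfolding L1_Linf_norm_def
proof (rule SUP_least)
  fix f :: "(nat \<Rightarrow> real) \<Rightarrow> complex"
  assume "f \<in> {f. integrable (torus d) f \<and> (LINT x|torus d. norm (f x)) \<le> 1}"
  then have f: "(LINT x|torus d. norm (f x)) \<le> 1" by simp
  let ?S = "shell_points d \<beta> \<Lambda> \<delta>"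
  let ?w = "\<lambda>k. chi ((sqrt (quad_form d \<beta> (\<lambda>i. real_of_int (k i))) - \<Lambda>) / \<delta>)"
  have w01: "0 \<le> ?w k" "?w k \<le> 1" for k using chi by (auto simp: is_cutoff_def)
  have w0: "?w k = 0" if "k \<in> lattice d - ?S" for k
  proof (rule ccontr)
    let ?y = "(sqrt (quad_form d \<beta> (\<lambda>i. real_of_int (k i))) - \<Lambda>) / \<delta>"
    assume "?w k \<noteq> 0"
    then have "?y \<in> closure {x. chi x \<noteq> 0}" by (intro closure_subset[THEN subsetD]) simp
    then have "?y \<in> {- 1..1}" using chi by (auto simp: is_cutoff_def)
    then have "\<bar>?y\<bar> \<le> 1" by auto
    then have "\<bar>sqrt (quad_form d \<beta> (\<lambda>i. real_of_int (k i))) - \<Lambda>\<bar> \<le> \<delta>"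
      using \<delta> by (simp add: abs_divide pos_divide_le_eq)
    then show False using that by (simp add: shell_points_def)
  qed
  have eq: "spectral_proj chi d \<beta> \<Lambda> \<delta> f x
      = (\<Sum>k\<in>?S. complex_of_real (?w k) * fourier_coeff d f k * character d k x)" for x
  proof -
    have "spectral_proj chi d \<beta> \<Lambda> \<delta> f x
        = (\<Sum>\<^sub>\<infinity>k\<in>?S. complex_of_real (?w k) * fourier_coeff d f k * character d k x)"
      unfolding spectral_proj_def
      by (rule infsum_cong_neutral) (use w0 in \<open>auto simp: shell_points_def\<close>)
    then show ?thesis using fin by simp
  qed
  have le: "norm (spectral_proj chi d \<beta> \<Lambda> \<delta> f x) \<le> real (card ?S)" for x
  proof -
    have "norm (spectral_proj chi d \<beta> \<Lambda> \<delta> f x) \<le> (\<Sum>k\<in>?S. 1)"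
      unfolding eq
    proof (rule sum_norm_le)
      fix k
      have "\<bar>?w k\<bar> * norm (fourier_coeff d f k) \<le> 1 * 1"
        using w01[of k] fourier_coeff_le[OF f, of k] by (intro mult_mono) auto
      then show "norm (complex_of_real (?w k) * fourier_coeff d f k * character d k x) \<le> 1"
        by (simp add: norm_mult)
    qed
    then show ?thesis by simp
  qed
  show "esssup (torus d) (\<lambda>x. ennreal (norm (spectral_proj chi d \<beta> \<Lambda> \<delta> f x))) \<le> ennreal (real (card ?S))"
  proof (rule esssup_I)
    show "(\<lambda>x. ennreal (norm (spectral_proj chi d \<beta> \<Lambda> \<delta> f x))) \<in> borel_measurable (torus d)"
      unfolding eq by measurable
    show "AE x in torus d. ennreal (norm (spectral_proj chi d \<beta> \<Lambda> \<delta> f x)) \<le> ennreal (real (card ?S))"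
      by (intro AE_I2 ennreal_leI le)
  qed
qed

section \<open>Optimising the moment\<close>

definition max_moment :: "nat \<Rightarrow> nat \<Rightarrow> real \<Rightarrow> real \<Rightarrow> real" where
  "max_moment b d \<delta> \<Lambda> = (MAX b\<^sub>2\<in>{0..min b (d + 1)}.
     \<delta> ^ b\<^sub>2 * \<Lambda> powi (- (int b\<^sub>2)\<^sup>2 + (int b + int d) * int b\<^sub>2 + 1 - int b))"

lemma max_moment_ge:
  assumes "b\<^sub>2 \<le> min b (d + 1)"
  shows "\<delta> ^ b\<^sub>2 * \<Lambda> powi (- (int b\<^sub>2)\<^sup>2 + (int b + int d) * int b\<^sub>2 + 1 - int b) \<le> max_moment b d \<delta> \<Lambda>"
  unfolding max_moment_def using assms by (intro Max_ge finite_imageI imageI) auto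

lemma max_moment_nonneg:
  assumes "0 < \<delta>" "0 < \<Lambda>"
  shows "0 \<le> max_moment b d \<delta> \<Lambda>"
  using assms by (intro order_trans[OF _ max_moment_ge[of 0]]) auto

lemma moment_sum_le_max_moment:
  assumes "1 \<le> b" "0 < \<delta>" "1 < \<Lambda>"
  shows "moment_sum (b - 1) d \<delta> \<Lambda> \<le> real (d + 1) * (1 / \<delta> * max_moment b d \<delta> \<Lambda>)"
proof -
  let ?f = "\<lambda>b\<^sub>2. \<delta> ^ b\<^sub>2 * \<Lambda> powi (- (int b\<^sub>2)\<^sup>2 + (int b + int d) * int b\<^sub>2 + 1 - int b)"
  let ?X = "1 / \<delta> * max_moment b d \<delta> \<Lambda>"
  have X0: "0 \<le> ?X" using max_moment_nonneg[of \<delta> \<Lambda> b d] assms by simp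
  have "moment_sum (b - 1) d \<delta> \<Lambda> \<le> (\<Sum>r\<le>min (b - 1) d. ?X)"
    unfolding moment_sum_def
  proof (rule sum_mono)
    fix r assume "r \<in> {..min (b - 1) d}"
    then have r: "r \<le> b - 1" "r \<le> d" by auto
    have e: "real d + real r * real (b - 1 + d) - real r * (real r + 1)
        = real_of_int (- (int (Suc r))\<^sup>2 + (int b + int d) * int (Suc r) + 1 - int b)"
      using assms(1) by (simp add: of_nat_diff power2_eq_square algebra_simps)
    have "\<delta> ^ r * \<Lambda> powr (real d + real r * real (b - 1 + d) - real r * (real r + 1)) = 1 / \<delta> * ?f (Suc r)"
      unfolding e using assms by (subst powr_real_of_int') auto
    also have "\<dots> \<le> ?X"
      using r assms by (intro mult_left_mono max_moment_ge) auto
    finally show "\<delta> ^ r * \<Lambda> powr (real d + real r * real (b - 1 + d) - real r * (real r + 1)) \<le> ?X" .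
  qed
  also have "\<dots> = real (Suc (min (b - 1) d)) * ?X" by simp
  also have "\<dots> \<le> real (d + 1) * ?X" using X0 by (intro mult_right_mono) auto
  finally show ?thesis .
qed

text \<open>
  Passing from \<open>r - 1\<close> to \<open>r\<close> multiplies the term by \<open>\<delta> * \<Lambda> powr (m + d - 2 * r)\<close>.  This is at least 1 as
  long as \<open>m + d - 2 * r \<ge> a\<close>, so the terms increase up to the last one.
\<close>

lemma moment_sum_le_top_term:
  assumes \<delta>: "0 < \<delta>" and \<Lambda>: "1 < \<Lambda>" and a: "1 \<le> \<delta> * \<Lambda> powr real a"
    and gap: "2 * min m d + a \<le> m + d"
  shows "moment_sum m d \<delta> \<Lambda> \<le> real (d + 1) *
     (\<delta> ^ min m d * \<Lambda> powr (real d + real (min m d) * real (m + d) - real (min m d) * (real (min m d) + 1)))"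
proof -
  define s where "s = min m d"
  let ?E = "\<lambda>r::nat. real d + real r * real (m + d) - real r * (real r + 1)"
  let ?t = "\<delta> ^ s * \<Lambda> powr ?E s"
  have "moment_sum m d \<delta> \<Lambda> \<le> (\<Sum>r\<le>s. ?t)"
    unfolding moment_sum_def s_def[symmetric]
  proof (rule sum_mono)
    fix r assume "r \<in> {..s}"
    then have r: "r \<le> s" by simp
    define p where "p = s - r"
    have s: "s = r + p" using r by (simp add: p_def)
    have "real p * real a \<le> real p * (real m + real d - 1 - (real s + real r))"
    proof (cases "p = 0")
      case False
      then have "r + s + 1 \<le> 2 * s" using s by simp
      then have "r + s + 1 + a \<le> m + d" using gap unfolding s_def by linarith
      then have "real (r + s + 1 + a) \<le> real (m + d)" by (simp only: of_nat_le_iff)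
      then show ?thesis by (intro mult_left_mono) auto
    qed simp
    also have "\<dots> = ?E s - ?E r" unfolding s by (simp add: algebra_simps)
    finally have E: "?E r + real p * real a \<le> ?E s" by linarith
    have "\<delta> ^ r * \<Lambda> powr ?E r * 1 \<le> \<delta> ^ r * \<Lambda> powr ?E r * (\<delta> * \<Lambda> powr real a) ^ p"
      using a \<delta> by (intro mult_left_mono one_le_power) auto
    also have "\<dots> = \<delta> ^ s * \<Lambda> powr (?E r + real p * real a)"
      using \<Lambda> by (simp add: s power_add power_mult_distrib powr_add powr_power mult.commute)
    also have "\<dots> \<le> ?t" using \<delta> \<Lambda> by (intro mult_left_mono powr_mono E) auto
    finally show "\<delta> ^ r * \<Lambda> powr ?E r \<le> ?t" by simp
  qed
  also have "\<dots> = real (Suc s) * ?t" by simp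
  also have "\<dots> \<le> real (d + 1) * ?t" using \<delta> by (intro mult_right_mono) (auto simp: s_def)
  finally show ?thesis by (simp add: s_def)
qed

lemma statement_S_if_controlled:
  assumes d: "1 \<le> d" and chi: "is_cutoff chi" and co: "coercive_form d \<beta>"
    and tc: "tuples_controlled d (\<lambda>k. quad_form d \<beta> (\<lambda>i. real_of_int (k i)))"
  shows "statement_S chi d \<beta>"
proof -
  have unif: "\<exists>C>0. \<forall>b\<ge>1. \<forall>\<Lambda> \<delta>. 0 < \<delta> \<and> \<delta> < 1 \<and> 1 < \<Lambda> \<longrightarrow>
     L1_Linf_norm (torus d) (spectral_proj chi d \<beta> \<Lambda> \<delta>)
       \<le> ennreal (C * \<Lambda> powr \<epsilon> * moment_sum (b - 1) d \<delta> \<Lambda> powr (1 / real b))" if \<epsilon>: "0 < \<epsilon>" for \<epsilon>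
  proof -
    obtain C where C: "0 < C" "\<And>b \<Lambda> \<delta>. 1 \<le> b \<Longrightarrow> 0 < \<delta> \<Longrightarrow> \<delta> < 1 \<Longrightarrow> 1 < \<Lambda> \<Longrightarrow>
       real (card (shell_points d \<beta> \<Lambda> \<delta>)) \<le> C * \<Lambda> powr \<epsilon> * moment_sum (b - 1) d \<delta> \<Lambda> powr (1 / real b)"
      using shell_card_uniform[OF d co tc \<epsilon>] by blast
    have "L1_Linf_norm (torus d) (spectral_proj chi d \<beta> \<Lambda> \<delta>)
       \<le> ennreal (C * \<Lambda> powr \<epsilon> * moment_sum (b - 1) d \<delta> \<Lambda> powr (1 / real b))"
      if "1 \<le> b" "0 < \<delta>" "\<delta> < 1" "1 < \<Lambda>" for b \<Lambda> \<delta>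
      using L1_Linf_norm_le_card[OF chi that(2) finite_shell_points[OF co that(2-4)]] C(2)[OF that]
      by (meson ennreal_leI order_trans)
    then show ?thesis using C(1) by blast
  qed
  have root_le: "real (d + 1) powr (1 / real b) \<le> real (d + 1)" if "1 \<le> b" for b
    using powr_mono[of "1 / real b" 1 "real (d + 1)"] that by simp
  have "moment_bound chi d \<beta>"
    unfolding moment_bound_def max_moment_def[symmetric]
  proof (intro allI impI)
    fix \<epsilon> :: real assume \<epsilon>: "0 < \<epsilon>"
    obtain C where C: "0 < C" "\<And>b \<Lambda> \<delta>. 1 \<le> b \<Longrightarrow> 0 < \<delta> \<Longrightarrow> \<delta> < 1 \<Longrightarrow> 1 < \<Lambda> \<Longrightarrow>
       L1_Linf_norm (torus d) (spectral_proj chi d \<beta> \<Lambda> \<delta>)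
       \<le> ennreal (C * \<Lambda> powr \<epsilon> * moment_sum (b - 1) d \<delta> \<Lambda> powr (1 / real b))"
      using unif[OF \<epsilon>] by blast
    have "L1_Linf_norm (torus d) (spectral_proj chi d \<beta> \<Lambda> \<delta>) \<le> ennreal (C * real (d + 1) *
        \<delta> powr (- 1 / real b) * \<Lambda> powr \<epsilon> * max_moment b d \<delta> \<Lambda> powr (1 / real b))"
      if b: "1 \<le> b" and h: "0 < \<delta>" "\<delta> < 1" "1 < \<Lambda>" for b and \<Lambda> \<delta> :: real
    proof -
      have M0: "0 \<le> max_moment b d \<delta> \<Lambda>" using h by (intro max_moment_nonneg) auto
      have "moment_sum (b - 1) d \<delta> \<Lambda> powr (1 / real b) \<le> (real (d + 1) * (1 / \<delta> * max_moment b d \<delta> \<Lambda>)) powr (1 / real b)"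
        using h by (intro powr_mono2 moment_sum_le_max_moment moment_sum_nonneg b) auto
      also have "\<dots> = real (d + 1) powr (1 / real b) * (\<delta> powr (- 1 / real b) * max_moment b d \<delta> \<Lambda> powr (1 / real b))"
        using h M0 by (simp add: powr_mult powr_divide powr_minus_divide)
      also have "\<dots> \<le> real (d + 1) * (\<delta> powr (- 1 / real b) * max_moment b d \<delta> \<Lambda> powr (1 / real b))"
        by (intro mult_right_mono root_le b) auto
      finally have "C * \<Lambda> powr \<epsilon> * moment_sum (b - 1) d \<delta> \<Lambda> powr (1 / real b)
         \<le> C * \<Lambda> powr \<epsilon> * (real (d + 1) * (\<delta> powr (- 1 / real b) * max_moment b d \<delta> \<Lambda> powr (1 / real b)))"
        using C(1) by (intro mult_left_mono) auto
      also have "\<dots> = C * real (d + 1) * \<delta> powr (- 1 / real b) * \<Lambda> powr \<epsilon> * max_moment b d \<delta> \<Lambda> powr (1 / real b)" by simp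
      finally show ?thesis using C(2)[OF b h] by (meson ennreal_leI order_trans)
    qed
    moreover have "0 < C * real (d + 1)" using C(1) by simp
    ultimately show "\<exists>C>0. \<forall>b\<ge>1. \<forall>lam \<delta>. 0 < \<delta> \<and> \<delta> < 1 \<and> 1 < lam \<longrightarrow>
        L1_Linf_norm (torus d) (spectral_proj chi d \<beta> lam \<delta>) \<le>
        ennreal (C * \<delta> powr (- 1 / real b) * lam powr \<epsilon> * max_moment b d \<delta> lam powr (1 / real b))" by blast
  qed
  moreover have "range_bound chi d \<beta>"
    unfolding range_bound_def
  proof (intro allI impI)
    fix \<epsilon> :: real assume \<epsilon>: "0 < \<epsilon>"
    obtain C where C: "0 < C" "\<And>b \<Lambda> \<delta>. 1 \<le> b \<Longrightarrow> 0 < \<delta> \<Longrightarrow> \<delta> < 1 \<Longrightarrow> 1 < \<Lambda> \<Longrightarrow>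
       L1_Linf_norm (torus d) (spectral_proj chi d \<beta> \<Lambda> \<delta>)
       \<le> ennreal (C * \<Lambda> powr \<epsilon> * moment_sum (b - 1) d \<delta> \<Lambda> powr (1 / real b))"
      using unif[OF \<epsilon>] by blast
    let ?G = "\<lambda>a lam \<delta>. if a < d then
             \<delta> powr (1 - 1 / (real d + 1 - real a)) *
             lam powr (real d - 1 + 1 / (real d + 1 - real a) + \<epsilon>)
           else
             \<delta> powr (1 - (1 + real a) / (real d + 1 + real a)) *
             lam powr (real d - 1 + (1 + real a) / (real d + 1 + real a) + \<epsilon>)"
    have key: "L1_Linf_norm (torus d) (spectral_proj chi d \<beta> \<Lambda> \<delta>) \<le> ennreal (C * real (d + 1) * ?G a \<Lambda> \<delta>)"
      if a: "1 \<le> a" and h: "0 < \<delta>" "\<delta> < 1" "1 < \<Lambda>" and low: "\<Lambda> powi (- int a) \<le> \<delta>" for a :: nat and \<Lambda> \<delta> :: real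
    proof -
      have "\<Lambda> powr real a * \<Lambda> powi (- int a) = 1"
        using h by (simp add: power_int_minus powr_realpow)
      then have a1: "1 \<le> \<delta> * \<Lambda> powr real a"
        using mult_left_mono[OF low, of "\<Lambda> powr real a"] by (simp add: mult.commute)
      \<comment> \<open>The number \<open>b\<close> is the denominator in the exponents of the claim; for both choices the
        largest index \<open>s\<close> in the moment sum satisfies \<open>m + d - 2 * s = a\<close>.\<close>
      define b where "b = (if a < d then d + 1 - a else d + 1 + a)"
      have b: "1 \<le> b" by (cases "a < d") (simp_all add: b_def Suc_diff_le)
      let ?m = "b - 1"
      define s where "s = min ?m d"
      let ?E = "real d + real s * real (?m + d) - real s * (real s + 1)"
      have gap: "2 * min ?m d + a \<le> ?m + d" 
      proof (cases "a < d")
        case True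
        then have "?m = d - a" by (simp add: b_def)
        then show ?thesis using True by simp
      next
        case False
        then have "?m = d + a" by (simp add: b_def)
        then show ?thesis by simp
      qed
      have root: "(\<delta> ^ s * \<Lambda> powr ?E) powr (1 / real b) = \<delta> powr (real s / real b) * \<Lambda> powr (?E / real b)"
        using h by (simp add: powr_mult powr_powr powr_realpow[symmetric])
      have G: "\<delta> powr (real s / real b) * \<Lambda> powr (?E / real b) * \<Lambda> powr \<epsilon> = ?G a \<Lambda> \<delta>"
      proof (cases "a < d")
        case True
        then have s: "real s = real d - real a" and rb: "real b = real d + 1 - real a"
          by (auto simp: s_def b_def of_nat_diff)
        have rm: "real (?m + d) = 2 * real d - real a" using True by (simp add: b_def of_nat_diff)
        have pos: "0 < real d + 1 - real a" using True by linarith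
        have "real s / real b = 1 - 1 / (real d + 1 - real a)" unfolding s rb using pos by (simp add: field_simps)
        moreover have "?E / real b = real d - 1 + 1 / (real d + 1 - real a)"
          unfolding s rb rm using pos by (simp add: field_simps)
        ultimately show ?thesis using True by (simp add: powr_add)
      next
        case False
        then have s: "real s = real d" and rb: "real b = real d + 1 + real a"
          by (auto simp: s_def b_def)
        have rm: "real (?m + d) = 2 * real d + real a" using False by (simp add: b_def)
        have pos: "0 < real d + 1 + real a" by linarith
        have "real s / real b = 1 - (1 + real a) / (real d + 1 + real a)" unfolding s rb using pos by (simp add: field_simps)
        moreover have "?E / real b = real d - 1 + (1 + real a) / (real d + 1 + real a)"
          unfolding s rb rm using pos by (simp add: field_simps)
        ultimately show ?thesis using False by (simp add: powr_add)
      qed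
      have "moment_sum ?m d \<delta> \<Lambda> powr (1 / real b) \<le> (real (d + 1) * (\<delta> ^ s * \<Lambda> powr ?E)) powr (1 / real b)"
        using h moment_sum_le_top_term[OF h(1,3) a1 gap] unfolding s_def by (intro powr_mono2 moment_sum_nonneg) auto
      also have "\<dots> = real (d + 1) powr (1 / real b) * (\<delta> powr (real s / real b) * \<Lambda> powr (?E / real b))"
        unfolding root[symmetric] by (rule powr_mult)
      also have "\<dots> \<le> real (d + 1) * (\<delta> powr (real s / real b) * \<Lambda> powr (?E / real b))"
        by (intro mult_right_mono root_le b) auto
      finally have "C * \<Lambda> powr \<epsilon> * moment_sum ?m d \<delta> \<Lambda> powr (1 / real b)
          \<le> C * \<Lambda> powr \<epsilon> * (real (d + 1) * (\<delta> powr (real s / real b) * \<Lambda> powr (?E / real b)))"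
        using C(1) by (intro mult_left_mono) auto
      also have "\<dots> = C * real (d + 1) * (\<delta> powr (real s / real b) * \<Lambda> powr (?E / real b) * \<Lambda> powr \<epsilon>)"
        by simp
      finally show ?thesis unfolding G using C(2)[OF b h] by (meson ennreal_leI order_trans)
    qed
    show "\<exists>C>0. \<forall>a::nat\<ge>1. \<forall>lam \<delta>.
        0 < \<delta> \<and> \<delta> < 1 \<and> 1 < lam \<and> lam powi (- int a) \<le> \<delta> \<and> \<delta> \<le> lam powi (1 - int a) \<longrightarrow>
        L1_Linf_norm (torus d) (spectral_proj chi d \<beta> lam \<delta>) \<le> ennreal (C * ?G a lam \<delta>)"
    proof (intro exI[of _ "C * real (d + 1)"] conjI allI impI)
      show "0 < C * real (d + 1)" using C(1) by simp
      fix a :: nat and lam \<delta> :: real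
      assume "1 \<le> a" and "0 < \<delta> \<and> \<delta> < 1 \<and> 1 < lam \<and> lam powi (- int a) \<le> \<delta> \<and> \<delta> \<le> lam powi (1 - int a)"
      then show "L1_Linf_norm (torus d) (spectral_proj chi d \<beta> lam \<delta>) \<le> ennreal (C * real (d + 1) * ?G a lam \<delta>)"
        using key by blast
    qed
  qed
  ultimately show ?thesis by (simp add: statement_S_def)
qed

section \<open>The two families of quadratic forms\<close>

text \<open>
  By the inequality between arithmetic and geometric means, the off-diagonal part is at most one tenth
  of the sum of the squares of the coordinates.
\<close>

lemma admissible_coercive:
  assumes d: "1 \<le> d" and off: "\<And>i j. i \<in> {1..d} \<Longrightarrow> j \<in> {1..d} \<Longrightarrow> i \<noteq> j \<Longrightarrow> \<bar>\<beta> i j\<bar> \<le> 1 / (10 * real d ^ 2)"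
    and diag: "\<And>i. i \<in> {1..d} \<Longrightarrow> 1 \<le> \<beta> i i"
  shows "coercive_form d \<beta>"
  unfolding coercive_form_def
proof (intro allI ballI)
  fix x :: "nat \<Rightarrow> real" and l assume l: "l \<in> {1..d}"
  let ?c = "1 / (10 * real d ^ 2)"
  define S where "S = (\<Sum>i=1..d. (x i)\<^sup>2)"
  have S0: "0 \<le> S" unfolding S_def by (intro sum_nonneg) auto
  have d0: "0 < real d" using d by simp
  have "(\<Sum>i=1..d. \<Sum>j=1..d. (if i = j then (x i)\<^sup>2 else 0) - ?c * (((x i)\<^sup>2 + (x j)\<^sup>2) / 2)) \<le> quad_form d \<beta> x"
    unfolding quad_form_def
  proof (intro sum_mono)
    fix i j assume ij: "i \<in> {1..d}" "j \<in> {1..d}"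
    show "(if i = j then (x i)\<^sup>2 else 0) - ?c * (((x i)\<^sup>2 + (x j)\<^sup>2) / 2) \<le> \<beta> i j * x i * x j"
    proof (cases "i = j")
      case True
      have "1 * (x i)\<^sup>2 \<le> \<beta> i i * (x i)\<^sup>2" using diag[OF ij(1)] by (intro mult_right_mono) auto
      moreover have "0 \<le> ?c * (((x i)\<^sup>2 + (x j)\<^sup>2) / 2)" by simp
      ultimately have "(x i)\<^sup>2 - ?c * (((x i)\<^sup>2 + (x j)\<^sup>2) / 2) \<le> \<beta> i i * (x i)\<^sup>2" by linarith
      also have "\<beta> i i * (x i)\<^sup>2 = \<beta> i j * x i * x j" using True by (simp add: power2_eq_square)
      finally show ?thesis using True by simp
    next
      case False
      have "0 \<le> (\<bar>x i\<bar> - \<bar>x j\<bar>)\<^sup>2" by simp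
      then have "\<bar>x i\<bar> * \<bar>x j\<bar> \<le> ((x i)\<^sup>2 + (x j)\<^sup>2) / 2"
        by (simp add: power2_diff)
      then have "\<bar>\<beta> i j\<bar> * (\<bar>x i\<bar> * \<bar>x j\<bar>) \<le> ?c * (((x i)\<^sup>2 + (x j)\<^sup>2) / 2)"
        using off[OF ij False] by (intro mult_mono) auto
      then have "\<bar>\<beta> i j * x i * x j\<bar> \<le> ?c * (((x i)\<^sup>2 + (x j)\<^sup>2) / 2)"
        by (simp add: abs_mult mult.assoc)
      then show ?thesis using False by (simp add: abs_le_iff)
    qed
  qed
  also have "(\<Sum>i=1..d. \<Sum>j=1..d. (if i = j then (x i)\<^sup>2 else 0) - ?c * (((x i)\<^sup>2 + (x j)\<^sup>2) / 2))
      = S - ?c * (real d * S)"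
  proof -
    have "(\<Sum>i=1..d. \<Sum>j=1..d. (if i = j then (x i)\<^sup>2 else 0)) = S" by (simp add: S_def)
    moreover have "(\<Sum>i=1..d. \<Sum>j=1..d. ((x i)\<^sup>2 + (x j)\<^sup>2) / 2) = real d * S"
      by (simp add: S_def sum.distrib sum_divide_distrib[symmetric] sum_distrib_left[symmetric])
    ultimately show ?thesis by (simp only: sum_subtractf sum_distrib_left[symmetric])
  qed
  finally have "S - ?c * (real d * S) \<le> quad_form d \<beta> x" .
  moreover have "?c * (real d * S) \<le> S / 10"
  proof -
    have "?c * (real d * S) = S / (10 * real d)" using d0 by (simp add: power2_eq_square)
    also have "\<dots> \<le> S / 10" using d S0 by (intro divide_left_mono) auto
    finally show ?thesis .
  qed
  ultimately have "9 / 10 * S \<le> quad_form d \<beta> x" by linarith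
  moreover have "(x l)\<^sup>2 \<le> S" unfolding S_def using l by (intro member_le_sum) auto
  ultimately show "4 / 9 * (x l)\<^sup>2 \<le> quad_form d \<beta> x" using zero_le_power2[of "x l"] by linarith
qed

lemma quad_form_split_diag:
  "quad_form d \<beta> x = (\<Sum>i=1..d. \<beta> i i * (x i)\<^sup>2) + (\<Sum>i=1..d. \<Sum>j\<in>{1..d} - {i}. \<beta> i j * x i * x j)"
proof -
  have "(\<Sum>j=1..d. \<beta> i j * x i * x j) = \<beta> i i * (x i)\<^sup>2 + (\<Sum>j\<in>{1..d} - {i}. \<beta> i j * x i * x j)"
    if "i \<in> {1..d}" for i
    by (subst sum.remove[OF _ that]) (auto simp: power2_eq_square)
  then show ?thesis unfolding quad_form_def sum.distrib[symmetric] by (intro sum.cong refl)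
qed

lemma diagonal_family_with_diag:
  "diagonal_family {1..d} {1..d} (\<lambda>i. i) d
     (\<lambda>v k. quad_form d (with_diag \<beta> v) (\<lambda>i. real_of_int (k i)))
     (\<lambda>v k. \<Sum>i=1..d. \<Sum>j\<in>{1..d} - {i}. \<beta> i j * real_of_int (k i) * real_of_int (k j))"
proof
  fix w :: "nat \<Rightarrow> real" and k :: "nat \<Rightarrow> int"
  have "(\<Sum>j\<in>{1..d} - {i}. with_diag \<beta> w i j * real_of_int (k i) * real_of_int (k j))
      = (\<Sum>j\<in>{1..d} - {i}. \<beta> i j * real_of_int (k i) * real_of_int (k j))" for i
    by (intro sum.cong) (auto simp: with_diag_def)
  then show "quad_form d (with_diag \<beta> w) (\<lambda>i. real_of_int (k i)) =
      (\<Sum>c=1..d. w c * (real_of_int (k c))\<^sup>2)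
      + (\<Sum>i=1..d. \<Sum>j\<in>{1..d} - {i}. \<beta> i j * real_of_int (k i) * real_of_int (k j))"
    unfolding quad_form_split_diag by (simp add: with_diag_def)
qed (auto simp: bij_betw_def)

lemma finite_upper_indices: "finite (upper_indices d)"
  by (rule finite_subset[of _ "{1..d} \<times> {1..d}"]) (auto simp: upper_indices_def)

lemma diagonal_family_sym_matrix:
  "diagonal_family (upper_indices d) ((\<lambda>i. (i, i)) ` {1..d}) fst d
     (\<lambda>w k. quad_form d (sym_matrix w) (\<lambda>i. real_of_int (k i)))
     (\<lambda>w k. \<Sum>i=1..d. \<Sum>j\<in>{1..d} - {i}. sym_matrix w i j * real_of_int (k i) * real_of_int (k j))"
proof
  show "finite (upper_indices d)" by (rule finite_upper_indices)
  show "(\<lambda>i. (i, i)) ` {1..d} \<subseteq> upper_indices d" by (auto simp: upper_indices_def)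
  show "bij_betw fst ((\<lambda>i. (i, i)) ` {1..d}) {1..d}"
    by (auto simp: bij_betw_def inj_on_def image_image)
next
  fix w :: "nat \<times> nat \<Rightarrow> real" and k :: "nat \<Rightarrow> int"
  show "quad_form d (sym_matrix w) (\<lambda>i. real_of_int (k i)) =
      (\<Sum>c\<in>(\<lambda>i. (i, i)) ` {1..d}. w c * (real_of_int (k (fst c)))\<^sup>2)
      + (\<Sum>i=1..d. \<Sum>j\<in>{1..d} - {i}. sym_matrix w i j * real_of_int (k i) * real_of_int (k j))"
    unfolding quad_form_split_diag by (subst sum.reindex) (auto simp: inj_on_def sym_matrix_def)
next
  fix w w' :: "nat \<times> nat \<Rightarrow> real" and k :: "nat \<Rightarrow> int"
  assume eq: "\<And>c. c \<in> upper_indices d - (\<lambda>i. (i, i)) ` {1..d} \<Longrightarrow> w c = w' c"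
  have "sym_matrix w i j = sym_matrix w' i j" if "i \<in> {1..d}" "j \<in> {1..d} - {i}" for i j
    unfolding sym_matrix_def using that by (intro eq) (auto simp: upper_indices_def)
  then show "(\<Sum>i=1..d. \<Sum>j\<in>{1..d} - {i}. sym_matrix w i j * real_of_int (k i) * real_of_int (k j))
      = (\<Sum>i=1..d. \<Sum>j\<in>{1..d} - {i}. sym_matrix w' i j * real_of_int (k i) * real_of_int (k j))"
    by (intro sum.cong refl) simp
next
  fix k :: "nat \<Rightarrow> int"
  have "(\<lambda>w. sym_matrix w i j) \<in> borel_measurable (Pi\<^sub>M (upper_indices d) (\<lambda>_. lborel))"
    if "i \<in> {1..d}" "j \<in> {1..d}" for i j
  proof -
    have "(min i j, max i j) \<in> upper_indices d" using that by (auto simp: upper_indices_def)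
    then show ?thesis unfolding sym_matrix_def
      using measurable_component_singleton[of "(min i j, max i j)" "upper_indices d" "\<lambda>_. lborel :: real measure"] by simp
  qed
  then show "(\<lambda>w. \<Sum>i=1..d. \<Sum>j\<in>{1..d} - {i}. sym_matrix w i j * real_of_int (k i) * real_of_int (k j))
      \<in> borel_measurable (Pi\<^sub>M (upper_indices d) (\<lambda>_. lborel))"
    by (intro borel_measurable_sum borel_measurable_times measurable_const) auto
qed

lemma admissible_off_diag_abs_le:
  assumes "admissible_off_diag d \<beta>" "i \<in> {1..d}" "j \<in> {1..d}" "i \<noteq> j"
  shows "\<bar>\<beta> i j\<bar> \<le> 1 / (10 * real d ^ 2)"
proof -
  have "\<beta> i j \<in> {- 1 / (10 * real d ^ 2)..1 / (10 * real d ^ 2)}"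
    using assms unfolding admissible_off_diag_def by blast
  then have "- (1 / (10 * real d ^ 2)) \<le> \<beta> i j" "\<beta> i j \<le> 1 / (10 * real d ^ 2)" by simp_all
  then show ?thesis by linarith
qed

theorem theorem6p1:
  fixes d :: nat and chi :: "real \<Rightarrow> real"
  assumes "d \<ge> 1" and "is_cutoff chi"
  shows "(\<forall>\<beta>. admissible_off_diag d \<beta> \<longrightarrow>
            (AE v in Pi\<^sub>M {1..d} (\<lambda>_. lborel).
               (\<forall>i\<in>{1..d}. v i \<in> {1..2}) \<longrightarrow> statement_S chi d (with_diag \<beta> v)))
       \<and> (AE w in Pi\<^sub>M (upper_indices d) (\<lambda>_. lborel).
            admissible_off_diag d (sym_matrix w) \<and> (\<forall>i\<in>{1..d}. sym_matrix w i i \<in> {1..2}) \<longrightarrow>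
            statement_S chi d (sym_matrix w))"
proof (intro conjI allI impI)
  fix \<beta> assume adm: "admissible_off_diag d \<beta>"
  interpret diagonal_family "{1..d}" "{1..d}" "\<lambda>i. i" d
    "\<lambda>v k. quad_form d (with_diag \<beta> v) (\<lambda>i. real_of_int (k i))"
    "\<lambda>v k. \<Sum>i=1..d. \<Sum>j\<in>{1..d} - {i}. \<beta> i j * real_of_int (k i) * real_of_int (k j)"
    by (rule diagonal_family_with_diag)
  show "AE v in Pi\<^sub>M {1..d} (\<lambda>_. lborel). (\<forall>i\<in>{1..d}. v i \<in> {1..2}) \<longrightarrow> statement_S chi d (with_diag \<beta> v)"
    using AE_tuples_controlled AE_space
  proof eventually_elim
    case (elim v)
    show ?case
    proof
      assume v: "\<forall>i\<in>{1..d}. v i \<in> {1..2}"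
      then have "v \<in> region" using elim(2) unfolding region_def by (auto simp: space_PiM PiE_iff)
      moreover have "coercive_form d (with_diag \<beta> v)"
        using assms(1) admissible_off_diag_abs_le[OF adm] v by (intro admissible_coercive) (auto simp: with_diag_def)
      ultimately show "statement_S chi d (with_diag \<beta> v)"
        using elim(1) by (intro statement_S_if_controlled assms) auto
    qed
  qed
next
  let ?J = "(\<lambda>i. (i, i)) ` {1..d}"
  interpret diagonal_family "upper_indices d" ?J fst d
    "\<lambda>w k. quad_form d (sym_matrix w) (\<lambda>i. real_of_int (k i))"
    "\<lambda>w k. \<Sum>i=1..d. \<Sum>j\<in>{1..d} - {i}. sym_matrix w i j * real_of_int (k i) * real_of_int (k j)"
    by (rule diagonal_family_sym_matrix)
  show "AE w in Pi\<^sub>M (upper_indices d) (\<lambda>_. lborel).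
            admissible_off_diag d (sym_matrix w) \<and> (\<forall>i\<in>{1..d}. sym_matrix w i i \<in> {1..2}) \<longrightarrow>
            statement_S chi d (sym_matrix w)"
    using AE_tuples_controlled AE_space
  proof eventually_elim
    case (elim w)
    show ?case
    proof (intro impI, elim conjE)
      assume adm: "admissible_off_diag d (sym_matrix w)" and diag: "\<forall>i\<in>{1..d}. sym_matrix w i i \<in> {1..2}"
      have small: "\<bar>sym_matrix w i j\<bar> \<le> 1 / (10 * real d ^ 2)" if "i \<in> {1..d}" "j \<in> {1..d}" "i \<noteq> j" for i j
        using admissible_off_diag_abs_le[OF adm] that by blast
      have one: "1 / (10 * real d ^ 2) \<le> 1"
      proof -
        have "1 \<le> real d ^ 2" using assms(1) by (intro one_le_power) simp
        then have "1 \<le> 10 * real d ^ 2" by linarith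
        then show ?thesis by (subst divide_le_eq_1_pos) linarith+
      qed
      have "w \<in> region"
        unfolding region_def
      proof (rule PiE_I)
        fix c assume c: "c \<in> upper_indices d"
        then obtain i j where ij: "c = (i, j)" "1 \<le> i" "i \<le> j" "j \<le> d" by (auto simp: upper_indices_def)
        then have w: "w c = sym_matrix w i j" by (simp add: sym_matrix_def)
        show "w c \<in> (if c \<in> ?J then {1..2} else {- 1..1})"
        proof (cases "i = j")
          case True
          then show ?thesis using diag ij w by auto
        next
          case False
          then have "\<bar>sym_matrix w i j\<bar> \<le> 1" using ij by (intro order_trans[OF small one]) auto
          then have "- 1 \<le> w c" "w c \<le> 1" using w by linarith+
          then show ?thesis using False ij by auto
        qed
      qed (use elim(2) in \<open>auto simp: space_PiM PiE_iff extensional_def\<close>)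
      moreover have "coercive_form d (sym_matrix w)"
        using assms(1) diag by (intro admissible_coercive small) auto
      ultimately show "statement_S chi d (sym_matrix w)"
        using elim(1) by (intro statement_S_if_controlled assms) auto
    qed
  qed
qed

end
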